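(* Let $\sigma^2>0$, $B\ge1$, $0\le C\le1$, $0<D\le1$, and consider any $K$-armed bandit instance with $\sigma^2$-sub-Gaussian reward noise. Then the algorithm MS$^+$ run with parameters $B,C,D,\sigma^2$ satisfies, for every $T\ge1$ and every $c>0$, $$\mathbb{E}\,\mathsf{Reg}_T\le\sum_{a\in[K]:\,\Delta_a>0}\left[\frac{2\sigma^2(1+c)^2\,\ln\!\left(\frac{T\Delta_a^2}{2\sigma^2}\left(1+\ln\left(1+\frac{T\Delta_a^2}{2\sigma^2}\right)\right)\right)}{\Delta_a}+O\!\left(B\,\frac{\sigma^2(1+c)^2\ln\left(1+\ln\left(\frac{T\Delta_a^2}{2\sigma^2}\right)\right)}{c^2\Delta_a}+\Delta_a\right)\right],$$ where $O(\cdot)$ hides a multiplicative constant that may depend on $C$ and $D$ only.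
   Context: **Bandit problem.** There are $K$ arms, $[K]=\{1,\dots,K\}$. Arm $i$ has a reward distribution $\nu_i$ on $\mathbb{R}$ with unknown mean $\mu_i\in\mathbb{R}$, and $\nu_i$ is $\sigma^2$-sub-Gaussian: if $y\sim\nu_i$ then $\mathbb{E}[\exp(\lambda(y-\mu_i))]\le\exp(\lambda^2\sigma^2/2)$ for all $\lambda\in\mathbb{R}$. At each time $t=1,2,\dots$ the learner chooses an arm $I_t\in[K]$ (possibly at random, based on past arms and rewards), then receives a reward $y_t$ drawn from $\nu_{I_t}$, independently of the past given $I_t$. The algorithm knows $\sigma^2$. **Gaps and regret.** $\Delta_a:=\max_{b\in[K]}\mu_b-\mu_a$. For an integer time horizon $T\ge1$, the (pseudo-)regret is $\mathsf{Reg}_T=\sum_{t=1}^T\left(\max_{a\in[K]}\mu_a-\mu_{I_t}\right)$. **Empirical quantities.** $N_{t,a}$ is the number of times arm $a$ has been pulled up to and including time $t$; $\hat\mu_{t,a}$ is the average of the rewards obtained from arm $a$ up to and including time $t$; $\hat\Delta_{t,a}:=\max_{b}\hat\mu_{t,b}-\hat\mu_{t,a}$. **Algorithm MS$^+$ (Maillard Sampling$^+$).** Input: $B\ge1$, $0\le C\le1$, $0<D\le1$, $\sigma^2>0$. For $t\le K$: pull arm $I_t=t$. For $t>K$: for every arm $a$ with $\hat\mu_{t-1,a}=\max_b\hat\mu_{t-1,b}$ set $$\hat p_{t,a}=B\left(1+C\ln\left(1+\ln\left(\tfrac{t}{N_{t-1,a}}\right)\right)\right);$$ for every other arm set $$\hat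 p_{t,a}=\exp\!\left(-\tfrac{1}{2\sigma^2}N_{t-1,a}\hat\Delta_{t-1,a}^2+\ln\left(1+\tfrac{D}{2\sigma^2}N_{t-1,a}\hat\Delta_{t-1,a}^2\right)\right);$$ then draw $I_t$ (conditionally on the past) from $p_{t,a}=\hat p_{t,a}/\sum_b\hat p_{t,b}$.
   Formalization: For small TΔ_a²/(2σ²) the displayed bound is undefined or false; the formal version replaces the argument of the leading logarithm by its maximum with 1, and TΔ_a²/(2σ²) inside ln(1+ln(·)) of the O-term by its maximum with e. *)

theory Defs
  imports "HOL-Probability.Probability"
begin

section \<open>Bandit instances\<close>

text \<open>Arms are the numbers \<open>1, \<dots>, K\<close>; an instance is a family \<open>\<nu>\<close> of reward distributions, of
  which only \<open>\<nu> 1, \<dots>, \<nu> K\<close> matter.\<close>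

definition mean :: "real measure \<Rightarrow> real" where
  "mean \<rho> = (\<integral>y. y \<partial>\<rho>)"

text \<open>The integrability conditions say that the mean and the moment generating function exist;
  without them a divergent Bochner integral would count as \<open>0\<close>.\<close>

definition subgaussian :: "real \<Rightarrow> real measure \<Rightarrow> bool" where
  "subgaussian \<sigma> \<rho> \<longleftrightarrow>
     prob_space \<rho> \<and> sets \<rho> = sets borel \<and> integrable \<rho> (\<lambda>y. y) \<and>
     (\<forall>l::real. integrable \<rho> (\<lambda>y. exp (l * (y - mean \<rho>))) \<and>
        (\<integral>y. exp (l * (y - mean \<rho>)) \<partial>\<rho>) \<le> exp (l\<^sup>2 * \<sigma>\<^sup>2 / 2))"

definition bandit_instance :: "nat \<Rightarrow> real \<Rightarrow> (nat \<Rightarrow> real measure) \<Rightarrow> bool" where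
  "bandit_instance K \<sigma> \<nu> \<longleftrightarrow> K \<ge> 1 \<and> (\<forall>a\<in>{1..K}. subgaussian \<sigma> (\<nu> a))"

definition gap :: "nat \<Rightarrow> (nat \<Rightarrow> real measure) \<Rightarrow> nat \<Rightarrow> real" where
  "gap K \<nu> a = Max ((\<lambda>b. mean (\<nu> b)) ` {1..K}) - mean (\<nu> a)"


section \<open>Histories and empirical quantities\<close>

text \<open>A history \<open>h\<close> stores the arm and the reward \<open>(I\<^sub>t, y\<^sub>t)\<close> of round \<open>t = 1, 2, \<dots>\<close> in
  \<open>h (t - 1)\<close>. Thus \<open>pulls h t a\<close> and \<open>emp_mean h t a\<close> take rounds \<open>1, \<dots>, t\<close> into account, and
  in round \<open>t\<close> the learner knows \<open>h\<close> on \<open>{0..<t - 1}\<close>.\<close>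

type_synonym history = "nat \<Rightarrow> nat \<times> real"

definition pulls :: "history \<Rightarrow> nat \<Rightarrow> nat \<Rightarrow> nat" where
  "pulls h t a = card {s. s < t \<and> fst (h s) = a}"

definition emp_mean :: "history \<Rightarrow> nat \<Rightarrow> nat \<Rightarrow> real" where
  "emp_mean h t a = (\<Sum>s | s < t \<and> fst (h s) = a. snd (h s)) / real (pulls h t a)"

definition best_emp_mean :: "nat \<Rightarrow> history \<Rightarrow> nat \<Rightarrow> real" where
  "best_emp_mean K h t = Max ((\<lambda>b. emp_mean h t b) ` {1..K})"

definition emp_gap :: "nat \<Rightarrow> history \<Rightarrow> nat \<Rightarrow> nat \<Rightarrow> real" where
  "emp_gap K h t a = best_emp_mean K h t - emp_mean h t a"


section \<open>The sampling rule of MS+\<close>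

definition ms_weight :: "real \<Rightarrow> real \<Rightarrow> real \<Rightarrow> real \<Rightarrow> nat \<Rightarrow> nat \<Rightarrow> history \<Rightarrow> nat \<Rightarrow> real" where
  "ms_weight B C D \<sigma> K t h a =
     (let N = real (pulls h (t - 1) a); \<Delta> = emp_gap K h (t - 1) a in
      if emp_mean h (t - 1) a = best_emp_mean K h (t - 1)
      then B * (1 + C * ln (1 + ln (real t / N)))
      else exp (- (1 / (2 * \<sigma>\<^sup>2)) * N * \<Delta>\<^sup>2 + ln (1 + D / (2 * \<sigma>\<^sup>2) * N * \<Delta>\<^sup>2)))"

definition ms_prob :: "real \<Rightarrow> real \<Rightarrow> real \<Rightarrow> real \<Rightarrow> nat \<Rightarrow> nat \<Rightarrow> history \<Rightarrow> nat \<Rightarrow> real" where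
  "ms_prob B C D \<sigma> K t h a =
     (if a \<in> {1..K}
      then ms_weight B C D \<sigma> K t h a / (\<Sum>b\<in>{1..K}. ms_weight B C D \<sigma> K t h b) else 0)"

definition ms_arm :: "real \<Rightarrow> real \<Rightarrow> real \<Rightarrow> real \<Rightarrow> nat \<Rightarrow> nat \<Rightarrow> history \<Rightarrow> nat pmf" where
  "ms_arm B C D \<sigma> K t h =
     (if t \<le> K then return_pmf t else embed_pmf (ms_prob B C D \<sigma> K t h))"


section \<open>The interaction process\<close>

abbreviation round_space :: "(nat \<times> real) measure" where
  "round_space \<equiv> count_space UNIV \<Otimes>\<^sub>M borel"

text \<open>Conditional law of \<open>(I\<^sub>t, y\<^sub>t)\<close> given the past: draw \<open>I\<^sub>t\<close> by the sampling rule, then \<open>y\<^sub>t\<close>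
  from \<open>\<nu> I\<^sub>t\<close>. The alternative for arms outside \<open>{1..K}\<close> is never drawn; it makes the kernel
  well-defined whatever \<open>\<nu>\<close> is there.\<close>

definition ms_round ::
  "real \<Rightarrow> real \<Rightarrow> real \<Rightarrow> real \<Rightarrow> nat \<Rightarrow> (nat \<Rightarrow> real measure) \<Rightarrow> nat \<Rightarrow> history \<Rightarrow> (nat \<times> real) measure"
  where
  "ms_round B C D \<sigma> K \<nu> t h =
     measure_pmf (ms_arm B C D \<sigma> K t h) \<bind>
       (\<lambda>a. distr (if a \<in> {1..K} then \<nu> a else return borel 0) round_space (\<lambda>y. (a, y)))"

text \<open>The law of the whole trajectory: the Ionescu-Tulcea measure of these kernels, i.e.
  \<open>PF.lim\<close> of the locale \<open>Ionescu_Tulcea\<close>, whose assumptions are established in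
  \<open>Ionescu_Tulcea_ms_round\<close> below.\<close>

definition ms_law ::
  "real \<Rightarrow> real \<Rightarrow> real \<Rightarrow> real \<Rightarrow> nat \<Rightarrow> (nat \<Rightarrow> real measure) \<Rightarrow> history measure" where
  "ms_law B C D \<sigma> K \<nu> =
     projective_family.lim UNIV
       (Ionescu_Tulcea.CI (\<lambda>n. ms_round B C D \<sigma> K \<nu> (Suc n)) (\<lambda>_. round_space)) (\<lambda>_. round_space)"

definition regret :: "nat \<Rightarrow> (nat \<Rightarrow> real measure) \<Rightarrow> nat \<Rightarrow> history \<Rightarrow> real" where
  "regret K \<nu> T h =
     (\<Sum>t\<in>{1..T}. Max ((\<lambda>a. mean (\<nu> a)) ` {1..K}) - mean (\<nu> (fst (h (t - 1)))))"

definition expected_regret ::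
  "real \<Rightarrow> real \<Rightarrow> real \<Rightarrow> real \<Rightarrow> nat \<Rightarrow> (nat \<Rightarrow> real measure) \<Rightarrow> nat \<Rightarrow> real" where
  "expected_regret B C D \<sigma> K \<nu> T = (\<integral>h. regret K \<nu> T h \<partial>ms_law B C D \<sigma> K \<nu>)"


section \<open>The process is well-defined\<close>

lemma pulls_le: "pulls h t a \<le> t"
  unfolding pulls_def using card_mono[of "{..<t}" "{s. s < t \<and> fst (h s) = a}"] by auto

lemma ms_weight_pos:
  assumes "B \<ge> 1" "0 \<le> C" "0 < D" "\<sigma> > 0" "t \<ge> 1"
  shows "ms_weight B C D \<sigma> K t h a > 0"
proof -
  let ?N = "real (pulls h (t - 1) a)"
  have "0 \<le> ln (real t / ?N)"
  proof (cases "pulls h (t - 1) a = 0")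
    case False
    then have "1 \<le> real t / ?N"
      using pulls_le[of h "t - 1" a] by (simp add: field_simps)
    then show ?thesis by simp
  qed simp
  then have "0 \<le> C * ln (1 + ln (real t / ?N))"
    using assms by (intro mult_nonneg_nonneg) auto
  then show ?thesis
    using assms by (auto simp: ms_weight_def Let_def intro!: mult_pos_pos add_pos_nonneg)
qed

lemma
  assumes "B \<ge> 1" "0 \<le> C" "0 < D" "\<sigma> > 0" "K \<ge> 1" "t \<ge> 1"
  shows ms_prob_nonneg: "0 \<le> ms_prob B C D \<sigma> K t h a"
    and nn_integral_ms_prob: "(\<integral>\<^sup>+a. ennreal (ms_prob B C D \<sigma> K t h a) \<partial>count_space UNIV) = 1"
proof -
  let ?S = "\<Sum>b\<in>{1..K}. ms_weight B C D \<sigma> K t h b"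
  have S: "?S > 0"
    using assms ms_weight_pos by (intro sum_pos) auto
  show nonneg: "0 \<le> ms_prob B C D \<sigma> K t h a" for a
    using S ms_weight_pos[of B C D \<sigma> t K h a] assms by (auto simp: ms_prob_def)
  have "(\<integral>\<^sup>+a. ennreal (ms_prob B C D \<sigma> K t h a) \<partial>count_space UNIV)
      = (\<Sum>a\<in>{1..K}. ennreal (ms_prob B C D \<sigma> K t h a))"
    by (subst nn_integral_count_space'[where A="{1..K}"]) (auto simp: ms_prob_def)
  also have "\<dots> = ennreal (\<Sum>a\<in>{1..K}. ms_prob B C D \<sigma> K t h a)"
    using nonneg by (simp add: sum_ennreal)
  also have "(\<Sum>a\<in>{1..K}. ms_prob B C D \<sigma> K t h a) = 1"
    using S by (simp add: ms_prob_def sum_divide_distrib[symmetric])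
  finally show "(\<integral>\<^sup>+a. ennreal (ms_prob B C D \<sigma> K t h a) \<partial>count_space UNIV) = 1"
    by simp
qed

lemma pmf_ms_arm:
  assumes "B \<ge> 1" "0 \<le> C" "0 < D" "\<sigma> > 0" "K \<ge> 1" "t > K"
  shows "pmf (ms_arm B C D \<sigma> K t h) a = ms_prob B C D \<sigma> K t h a"
  unfolding ms_arm_def using assms
  by (simp add: pmf_embed_pmf ms_prob_nonneg nn_integral_ms_prob)

lemma measurable_round_fst [measurable]:
  "i \<in> I \<Longrightarrow> (\<lambda>h. fst (h i)) \<in> measurable (PiM I (\<lambda>_. round_space)) (count_space UNIV)"
  by measurable

lemma measurable_round_snd [measurable]:
  "i \<in> I \<Longrightarrow> (\<lambda>h. snd (h i)) \<in> borel_measurable (PiM I (\<lambda>_. round_space))"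
  by measurable

lemma measurable_pulls:
  "(\<lambda>h. real (pulls h n a)) \<in> borel_measurable (PiM {0..<n} (\<lambda>_. round_space))"
proof -
  have "real (pulls h n a) = (\<Sum>s\<in>{0..<n}. if fst (h s) = a then 1 else 0)" for h
    by (auto simp: pulls_def sum.If_cases intro!: arg_cong[where f=card])
  then show ?thesis by simp
qed

lemma measurable_emp_mean:
  "(\<lambda>h. emp_mean h n a) \<in> borel_measurable (PiM {0..<n} (\<lambda>_. round_space))"
proof -
  have "(\<Sum>s | s < n \<and> fst (h s) = a. snd (h s)) = (\<Sum>s\<in>{0..<n}. if fst (h s) = a then snd (h s) else 0)"
    for h :: history
    by (auto simp: sum.If_cases intro!: sum.cong)
  then show ?thesis
    unfolding emp_mean_def using measurable_pulls[of n a] by simp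
qed

lemma measurable_best_emp_mean:
  "(\<lambda>h. best_emp_mean K h n) \<in> borel_measurable (PiM {0..<n} (\<lambda>_. round_space))"
  unfolding best_emp_mean_def
  by (intro borel_measurable_Max measurable_emp_mean) auto

lemma measurable_ms_prob:
  "(\<lambda>h. ms_prob B C D \<sigma> K (Suc n) h a) \<in> borel_measurable (PiM {0..<n} (\<lambda>_. round_space))"
proof -
  note [measurable] = measurable_pulls measurable_emp_mean measurable_best_emp_mean
  have [measurable]:
    "(\<lambda>h. ms_weight B C D \<sigma> K (Suc n) h b) \<in> borel_measurable (PiM {0..<n} (\<lambda>_. round_space))" for b
    unfolding ms_weight_def emp_gap_def Let_def diff_Suc_1 by measurable
  show ?thesis
    unfolding ms_prob_def by measurable
qed

lemma measurable_ms_arm: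
  assumes "B \<ge> 1" "0 \<le> C" "0 < D" "\<sigma> > 0" "K \<ge> 1"
  shows "(\<lambda>h. measure_pmf (ms_arm B C D \<sigma> K (Suc n) h))
    \<in> measurable (PiM {0..<n} (\<lambda>_. round_space)) (subprob_algebra (count_space UNIV))"
proof (rule measurable_subprob_algebra)
  fix A :: "nat set"
  have eq: "emeasure (measure_pmf p) A = (\<Sum>a. ennreal (pmf p a) * indicator A a)" for p :: "nat pmf"
    by (subst nn_integral_indicator[symmetric])
       (auto simp: nn_integral_measure_pmf nn_integral_count_space_nat)
  have [measurable]: "(\<lambda>h. pmf (ms_arm B C D \<sigma> K (Suc n) h) a)
      \<in> borel_measurable (PiM {0..<n} (\<lambda>_. round_space))" for a
  proof (cases "Suc n \<le> K")
    case False
    then have "(\<lambda>h. pmf (ms_arm B C D \<sigma> K (Suc n) h) a) = (\<lambda>h. ms_prob B C D \<sigma> K (Suc n) h a)"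
      using assms by (intro ext pmf_ms_arm) auto
    then show ?thesis
      using measurable_ms_prob by simp
  qed (simp add: ms_arm_def)
  show "(\<lambda>h. emeasure (measure_pmf (ms_arm B C D \<sigma> K (Suc n) h)) A)
      \<in> borel_measurable (PiM {0..<n} (\<lambda>_. round_space))"
    unfolding eq by measurable
qed (auto simp: subprob_space_measure_pmf)

lemma Ionescu_Tulcea_ms_round:
  assumes "B \<ge> 1" "0 \<le> C" "0 < D" "\<sigma> > 0" "bandit_instance K \<sigma> \<nu>"
  shows "Ionescu_Tulcea (\<lambda>n. ms_round B C D \<sigma> K \<nu> (Suc n)) (\<lambda>_. round_space)"
proof -
  have K: "K \<ge> 1" and sg: "\<And>a. a \<in> {1..K} \<Longrightarrow> prob_space (\<nu> a) \<and> sets (\<nu> a) = sets borel"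
    using assms by (auto simp: bandit_instance_def subgaussian_def)
  let ?R = "\<lambda>a. distr (if a \<in> {1..K} then \<nu> a else return borel 0) round_space (\<lambda>y. (a, y))"
  have prob_R: "prob_space (?R a)" for a
  proof -
    let ?\<rho> = "if a \<in> {1..K} then \<nu> a else return borel 0"
    have "prob_space ?\<rho>" "sets ?\<rho> = sets borel"
      using sg[of a] by (auto intro: prob_space_return)
    moreover from this(2) have "(\<lambda>y. (a, y)) \<in> measurable ?\<rho> round_space"
      by (simp cong: measurable_cong_sets)
    ultimately show ?thesis
      by (intro prob_space.prob_space_distr)
  qed
  have R: "?R \<in> measurable (count_space UNIV) (subprob_algebra round_space)"
    using prob_R by (auto simp: space_subprob_algebra intro!: prob_space_imp_subprob_space)
  have ms_round: "ms_round B C D \<sigma> K \<nu> t = (\<lambda>h. measure_pmf (ms_arm B C D \<sigma> K t h) \<bind> ?R)" for t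
    by (intro ext) (rule ms_round_def)
  show ?thesis
  proof (rule Ionescu_Tulcea.intro)
    show "ms_round B C D \<sigma> K \<nu> (Suc n) \<in> measurable (PiM {0..<n} (\<lambda>_. round_space))
        (subprob_algebra round_space)" for n
      unfolding ms_round by (rule measurable_bind2[OF measurable_ms_arm R]) (use assms K in auto)
    show "prob_space (ms_round B C D \<sigma> K \<nu> (Suc n) h)" for n h
    proof -
      have "?R \<in> measurable (measure_pmf (ms_arm B C D \<sigma> K (Suc n) h)) (subprob_algebra round_space)"
        using R by (simp add: measurable_cong_sets[OF sets_measure_pmf_count_space refl])
      then show ?thesis
        unfolding ms_round
        by (intro prob_space.prob_space_bind[OF prob_space_measure_pmf AE_I2[OF prob_R]])
    qed
  qed
qed

end

theory Submission
  imports Defs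
begin

text \<open>The regret is the gap-weighted sum of the expected pulls of the suboptimal arms. Fix a suboptimal
  arm \<open>a\<close> with gap \<open>\<Delta>\<close>, an optimal arm \<open>b\<close>, put \<open>x = T \<Delta>\<^sup>2 / (2 \<sigma>\<^sup>2)\<close>,
  \<open>L = ln (x (1 + ln (1 + x)))\<close> and \<open>\<epsilon> = c \<Delta> / (2 (1 + c))\<close>; only \<open>x \<ge> e\<close> is interesting. The first
  \<open>u = 2 \<sigma>\<^sup>2 (1 + c)\<^sup>2 L / \<Delta>\<^sup>2\<close> pulls of \<open>a\<close> give the leading term. Every later pull falls into one of
  three cases. If the empirical gap of \<open>a\<close> is at least \<open>\<Delta> / (1 + c) = \<Delta> - 2 \<epsilon>\<close>, the sampling weight is
  at most \<open>(1 + L) exp (- L) \<le> 2 / x\<close>. If \<open>a\<close> is overestimated by \<open>\<epsilon>\<close>, a sub-Gaussian bound per pull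
  of \<open>a\<close> suffices. Otherwise all empirical means are below \<open>\<mu>\<^sub>b - \<epsilon>\<close>; then the probability of pulling
  \<open>a\<close> is at most \<open>B (1 + ln (1 + ln x)) exp k / (1 + D k)\<close> times that of pulling \<open>b\<close>, where
  \<open>k = N\<^sub>b (\<mu>\<^sub>b - \<epsilon> - m)\<^sup>2 / (2 \<sigma>\<^sup>2)\<close> for the empirical mean \<open>m\<close> of \<open>b\<close>, so that the pulls of \<open>a\<close> are charged to pulls of \<open>b\<close> at a
  large deviation. The denominator \<open>1 + D k\<close> makes the sum over the deviation levels converge, hence
  this case costs \<open>O(\<sigma>\<^sup>2 / \<epsilon>\<^sup>2)\<close> up to the factor \<open>B (1 + ln (1 + ln x))\<close>.\<close>

section \<open>Conditioning on the past\<close>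

text \<open>The marginals of the projective limit are the measures \<open>CI J\<close>, and on an
  initial segment \<open>CI\<close> is the composition \<open>C 0 n\<close> of the first
  \<open>n\<close> kernels, started from the empty history.\<close>

lemma (in Ionescu_Tulcea) nn_integral_lim_restrict:
  assumes [measurable]: "f \<in> borel_measurable (PiM {0..<n} M)"
  shows "(\<integral>\<^sup>+h. f (restrict h {0..<n}) \<partial>PF.lim) = (\<integral>\<^sup>+h. f h \<partial>C 0 n (\<lambda>_. undefined))"
proof -
  have up: "up_to {0..<n} = n"
    by (intro antisym) (auto simp: up_to_iff, metis atLeastLessThan_iff finite_atLeastLessThan linorder_not_le order_refl up_to_less zero_le)
  have sC: "sets (C 0 n (\<lambda>_. undefined)) = sets (PiM {0..<n} M)"
    by (subst sets_C) auto
  have spC: "space (C 0 n (\<lambda>_. undefined)) = space (PiM {0..<n} M)"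
    by (subst space_C) auto
  have meas: "(\<lambda>h. restrict h {0..<n}) \<in> measurable PF.lim (PiM {0..<n} M)"
    by (subst measurable_cong_sets[OF PF.sets_lim refl]) (rule measurable_restrict_subset, simp)
  have "(\<integral>\<^sup>+h. f (restrict h {0..<n}) \<partial>PF.lim)
      = (\<integral>\<^sup>+h. f h \<partial>distr PF.lim (PiM {0..<n} M) (\<lambda>x. restrict x {0..<n}))"
    by (subst nn_integral_distr) (use meas in auto)
  also have "\<dots> = (\<integral>\<^sup>+h. f h \<partial>CI {0..<n})"
    by (subst distr_lim) auto
  also have "\<dots> = (\<integral>\<^sup>+h. f (restrict h {0..<n}) \<partial>C 0 n (\<lambda>_. undefined))"
    unfolding CI_def up
    by (subst nn_integral_distr) (auto simp: measurable_cong_sets[OF sC refl] intro!: measurable_restrict)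
  also have "\<dots> = (\<integral>\<^sup>+h. f h \<partial>C 0 n (\<lambda>_. undefined))"
    by (intro nn_integral_cong) (auto simp: spC space_PiM PiE_restrict simp del: restrict_apply)
  finally show ?thesis .
qed

text \<open>\<open>C 0 (Suc n)\<close> is \<open>C 0 n\<close> followed by the kernel of step
  \<open>n\<close>. The marginal formula is applied at \<open>Suc n\<close> and then backwards at
  \<open>n\<close>, so that the outer integral is again over the limit.\<close>

lemma (in Ionescu_Tulcea) nn_integral_lim_step:
  assumes G: "G \<in> borel_measurable (PiM {0..<Suc n} M)"
  shows "(\<integral>\<^sup>+h. G (restrict h {0..<Suc n}) \<partial>PF.lim)
    = (\<integral>\<^sup>+h. (\<integral>\<^sup>+r. G ((restrict h {0..<n})(n := r)) \<partial>P n (restrict h {0..<n})) \<partial>PF.lim)"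
proof -
  have spC: "space (C 0 n (\<lambda>_. undefined)) = space (PiM {0..<n} M)"
    by (subst space_C) auto
  have sC: "sets (C 0 n (\<lambda>_. undefined)) = sets (PiM {0..<n} M)"
    by (subst sets_C) auto
  \<comment> \<open>Returning from \<open>C 0 n\<close> to the limit requires the inner integral to
    be measurable in the past.\<close>
  have F: "(\<lambda>\<omega>. \<integral>\<^sup>+r. G (fun_upd \<omega> n r) \<partial>P n \<omega>) \<in> borel_measurable (PiM {0..<n} M)"
  proof -
    have "(\<lambda>\<omega>. \<integral>\<^sup>+x. G x \<partial>eP n \<omega>) \<in> borel_measurable (PiM {0..<n} M)"
      by (rule measurable_compose[OF measurable_eP nn_integral_measurable_subprob_algebra[OF G]])
    then show ?thesis
      by (subst measurable_cong[where g="\<lambda>\<omega>. \<integral>\<^sup>+x. G x \<partial>eP n \<omega>"])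
         (use G in \<open>auto simp: nn_integral_eP\<close>)
  qed
  have "(\<integral>\<^sup>+h. G (restrict h {0..<Suc n}) \<partial>PF.lim) = (\<integral>\<^sup>+h. G h \<partial>(C 0 n (\<lambda>_. undefined) \<bind> eP n))"
    using nn_integral_lim_restrict[OF G] by simp
  also have "\<dots> = (\<integral>\<^sup>+\<omega>. (\<integral>\<^sup>+x. G x \<partial>eP n \<omega>) \<partial>C 0 n (\<lambda>_. undefined))"
    by (rule nn_integral_bind[OF G]) (simp add: measurable_cong_sets[OF sC refl])
  also have "\<dots> = (\<integral>\<^sup>+\<omega>. (\<integral>\<^sup>+r. G (fun_upd \<omega> n r) \<partial>P n \<omega>) \<partial>C 0 n (\<lambda>_. undefined))"
    using G by (intro nn_integral_cong nn_integral_eP) (auto simp: spC)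
  finally show ?thesis
    using nn_integral_lim_restrict[OF F] by simp
qed

section \<open>Dependence on the observed rounds only\<close>

lemma pulls_cong: "(\<And>s. s < t \<Longrightarrow> h s = h' s) \<Longrightarrow> pulls h t a = pulls h' t a"
  unfolding pulls_def by (metis (mono_tags, lifting) Collect_cong)

lemma emp_mean_cong: "(\<And>s. s < t \<Longrightarrow> h s = h' s) \<Longrightarrow> emp_mean h t a = emp_mean h' t a"
  unfolding emp_mean_def using pulls_cong[of t h h' a]
  by (auto intro!: arg_cong2[where f="(/)"] sum.cong)

lemma best_emp_mean_cong:
  "(\<And>s. s < t \<Longrightarrow> h s = h' s) \<Longrightarrow> best_emp_mean K h t = best_emp_mean K h' t"
  unfolding best_emp_mean_def by (intro arg_cong[where f=Max] image_cong emp_mean_cong) auto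

lemma emp_gap_cong:
  "(\<And>s. s < t \<Longrightarrow> h s = h' s) \<Longrightarrow> emp_gap K h t a = emp_gap K h' t a"
  unfolding emp_gap_def using emp_mean_cong[of t h h' a] best_emp_mean_cong[of t h h' K] by simp

text \<open>The kernels receive histories cut off at \<open>t\<close>, while the argument works with
  full histories; this identifies the two sampling laws.\<close>

lemma ms_arm_cong:
  assumes "\<And>s. s < t \<Longrightarrow> h s = h' s"
  shows "ms_arm B C D \<sigma> K (Suc t) h = ms_arm B C D \<sigma> K (Suc t) h'"
proof -
  have "ms_weight B C D \<sigma> K (Suc t) h = ms_weight B C D \<sigma> K (Suc t) h'"
    using pulls_cong[of t h h'] emp_mean_cong[of t h h'] best_emp_mean_cong[of t h h' K]
      emp_gap_cong[of t h h' K] assms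
    by (intro ext) (simp add: ms_weight_def)
  then have "ms_prob B C D \<sigma> K (Suc t) h = ms_prob B C D \<sigma> K (Suc t) h'"
    by (intro ext) (simp add: ms_prob_def)
  then show ?thesis
    by (simp add: ms_arm_def)
qed

section \<open>The bandit process and its one-step conditional law\<close>

locale ms_bandit =
  fixes B C D \<sigma> :: real and K :: nat and \<nu> :: "nat \<Rightarrow> real measure"
  assumes B: "B \<ge> 1" and C: "0 \<le> C" "C \<le> 1" and D: "0 < D" "D \<le> 1" and \<sigma>: "\<sigma> > 0"
    and bandit: "bandit_instance K \<sigma> \<nu>"
begin

abbreviation "P \<equiv> ms_law B C D \<sigma> K \<nu>"
text \<open>As \<open>h n\<close> is round \<open>n + 1\<close>, the law of the arm \<open>fst (h n)\<close> given the past is \<open>q n h\<close>.\<close>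

abbreviation "q n h \<equiv> pmf (ms_arm B C D \<sigma> K (Suc n) h)"

sublocale IT: Ionescu_Tulcea "\<lambda>n. ms_round B C D \<sigma> K \<nu> (Suc n)" "\<lambda>_. round_space"
  using B C D \<sigma> bandit by (intro Ionescu_Tulcea_ms_round) auto

lemma K: "K \<ge> 1"
  using bandit by (simp add: bandit_instance_def)

lemma sub: "a \<in> {1..K} \<Longrightarrow> subgaussian \<sigma> (\<nu> a)"
  using bandit by (simp add: bandit_instance_def)

lemma sets_\<nu>: "a \<in> {1..K} \<Longrightarrow> sets (\<nu> a) = sets borel"
  using sub by (simp add: subgaussian_def)

lemma prob_\<nu>: "a \<in> {1..K} \<Longrightarrow> prob_space (\<nu> a)"
  using sub by (simp add: subgaussian_def)

lemma law_eq_lim: "P = IT.PF.lim"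
  by (simp add: ms_law_def)

lemma sets_law [measurable_cong]: "sets P = sets (PiM UNIV (\<lambda>_. round_space))"
  by (simp add: law_eq_lim)

lemma prob_space_law: "prob_space P"
proof
  have "(\<integral>\<^sup>+h. 1 \<partial>P) = (\<integral>\<^sup>+h. 1 \<partial>IT.C 0 0 (\<lambda>_. undefined))"
    using IT.nn_integral_lim_restrict[of "\<lambda>_. 1" 0] by (simp add: law_eq_lim)
  then show "emeasure P (space P) = 1"
    using prob_space.emeasure_space_1[OF IT.prob_space_C[of "\<lambda>_. undefined" 0 0]] by simp
qed

text \<open>Arms outside \<open>{1..K}\<close> have probability 0, so the integral over the drawn
  arm is a finite sum and the default reward law drops out.\<close>

lemma nn_integral_ms_round:
  assumes [measurable]: "f \<in> borel_measurable round_space"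
  shows "(\<integral>\<^sup>+r. f r \<partial>ms_round B C D \<sigma> K \<nu> (Suc n) h)
    = (\<Sum>a\<in>{1..K}. ennreal (q n h a) * (\<integral>\<^sup>+y. f (a, y) \<partial>\<nu> a))"
proof -
  let ?R = "\<lambda>a. distr (if a \<in> {1..K} then \<nu> a else return borel 0) round_space (\<lambda>y. (a, y))"
  have m: "(\<lambda>y. (a, y)) \<in> measurable (if a \<in> {1..K} then \<nu> a else return borel 0) round_space" for a
    using sets_\<nu>[of a] by (cases "a \<in> {1..K}") (auto cong: measurable_cong_sets)
  have "prob_space (?R a)" for a
    using prob_\<nu>[of a] m[of a] by (cases "a \<in> {1..K}") (auto intro!: prob_space.prob_space_distr prob_space_return)
  then have R: "?R \<in> measurable (measure_pmf (ms_arm B C D \<sigma> K (Suc n) h)) (subprob_algebra round_space)"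
    by (subst measurable_cong_sets[OF sets_measure_pmf_count_space refl])
       (auto simp: space_subprob_algebra intro!: prob_space_imp_subprob_space)
  have "(\<integral>\<^sup>+r. f r \<partial>ms_round B C D \<sigma> K \<nu> (Suc n) h)
      = (\<integral>\<^sup>+a. (\<integral>\<^sup>+r. f r \<partial>?R a) \<partial>measure_pmf (ms_arm B C D \<sigma> K (Suc n) h))"
    unfolding ms_round_def by (rule nn_integral_bind[OF _ R]) simp
  also have "\<dots> = (\<integral>\<^sup>+a. ennreal (q n h a) * (\<integral>\<^sup>+r. f r \<partial>?R a) \<partial>count_space UNIV)"
    by (simp add: nn_integral_measure_pmf)
  also have "\<dots> = (\<Sum>a\<in>{1..K}. ennreal (q n h a) * (\<integral>\<^sup>+r. f r \<partial>?R a))"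
  proof (rule nn_integral_count_space')
    fix a assume "a \<notin> {1..K}"
    then have "q n h a = 0"
    proof (cases "Suc n \<le> K")
      case True
      with \<open>a \<notin> {1..K}\<close> show ?thesis
        by (auto simp: ms_arm_def)
    next
      case False
      with \<open>a \<notin> {1..K}\<close> K B C D \<sigma> show ?thesis
        by (subst pmf_ms_arm) (auto simp: ms_prob_def)
    qed
    then show "ennreal (q n h a) * (\<integral>\<^sup>+r. f r \<partial>?R a) = 0"
      by simp
  qed auto
  also have "\<dots> = (\<Sum>a\<in>{1..K}. ennreal (q n h a) * (\<integral>\<^sup>+y. f (a, y) \<partial>\<nu> a))"
  proof (intro sum.cong refl)
    fix a assume a: "a \<in> {1..K}"
    have "(\<integral>\<^sup>+r. f r \<partial>?R a) = (\<integral>\<^sup>+y. f (a, y) \<partial>(if a \<in> {1..K} then \<nu> a else return borel 0))"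
      by (rule nn_integral_distr[OF m]) simp
    then show "ennreal (q n h a) * (\<integral>\<^sup>+r. f r \<partial>?R a) = ennreal (q n h a) * (\<integral>\<^sup>+y. f (a, y) \<partial>\<nu> a)"
      using a by simp
  qed
  finally show ?thesis .
qed

text \<open>The tower property for round \<open>n + 1\<close>. Locality of \<open>G\<close> removes
  the restrictions of the abstract version: coordinates beyond \<open>n\<close> may keep any
  value.\<close>

lemma nn_integral_law_step:
  assumes G: "G \<in> borel_measurable (PiM {0..<Suc n} (\<lambda>_. round_space))"
    and local: "\<And>h h'. (\<And>i. i \<le> n \<Longrightarrow> h i = h' i) \<Longrightarrow> G h = G h'"
  shows "(\<integral>\<^sup>+h. G h \<partial>P)
    = (\<integral>\<^sup>+h. (\<Sum>a\<in>{1..K}. ennreal (q n h a) * (\<integral>\<^sup>+y. G (h(n := (a, y))) \<partial>\<nu> a)) \<partial>P)"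
proof -
  have "(\<integral>\<^sup>+h. G h \<partial>P) = (\<integral>\<^sup>+h. G (restrict h {0..<Suc n}) \<partial>IT.PF.lim)"
    unfolding law_eq_lim by (intro nn_integral_cong local) simp
  also have "\<dots> = (\<integral>\<^sup>+h. (\<integral>\<^sup>+r. G ((restrict h {0..<n})(n := r))
      \<partial>ms_round B C D \<sigma> K \<nu> (Suc n) (restrict h {0..<n})) \<partial>IT.PF.lim)"
    by (rule IT.nn_integral_lim_step[OF G])
  also have "\<dots> = (\<integral>\<^sup>+h. (\<Sum>a\<in>{1..K}. ennreal (q n h a) * (\<integral>\<^sup>+y. G (h(n := (a, y))) \<partial>\<nu> a)) \<partial>P)"
    unfolding law_eq_lim
  proof (rule nn_integral_cong)
    fix h :: history
    have "(\<lambda>r. (restrict h {0..<n})(n := r)) \<in> measurable round_space (PiM {0..<Suc n} (\<lambda>_. round_space))"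
      by (rule measurable_fun_upd[where J="{0..<n}"]) (auto simp: space_PiM space_pair_measure PiE_iff)
    then have m: "(\<lambda>r. G ((restrict h {0..<n})(n := r))) \<in> borel_measurable round_space"
      by (rule measurable_compose[OF _ G])
    have "G ((restrict h {0..<n})(n := r)) = G (h(n := r))" for r
      by (rule local) simp
    moreover have "q n (restrict h {0..<n}) = q n h"
      by (subst ms_arm_cong[of n _ h]) auto
    ultimately show "(\<integral>\<^sup>+r. G ((restrict h {0..<n})(n := r)) \<partial>ms_round B C D \<sigma> K \<nu> (Suc n) (restrict h {0..<n}))
        = (\<Sum>a\<in>{1..K}. ennreal (q n h a) * (\<integral>\<^sup>+y. G (h(n := (a, y))) \<partial>\<nu> a))"
      using nn_integral_ms_round[OF m, of n "restrict h {0..<n}"] by simp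
  qed
  finally show ?thesis .
qed

end

section \<open>Deviations of the empirical means\<close>

lemma pulls_Suc: "pulls h (Suc t) a = pulls h t a + (if fst (h t) = a then 1 else 0)"
proof -
  have "{s. s < Suc t \<and> fst (h s) = a}
      = {s. s < t \<and> fst (h s) = a} \<union> (if fst (h t) = a then {t} else {})"
    by (auto simp: less_Suc_eq)
  then show ?thesis
    unfolding pulls_def by auto
qed

lemma pulls_eq_sum: "pulls h t a = (\<Sum>s<t. if fst (h s) = a then 1 else 0)"
  by (induction t) (auto simp: pulls_Suc, simp add: pulls_def)

lemma pulls_mono: "s \<le> t \<Longrightarrow> pulls h s a \<le> pulls h t a"
  by (rule lift_Suc_mono_le[where f="\<lambda>t. pulls h t a"]) (auto simp: pulls_Suc)

lemma pulls_less: "s < t \<Longrightarrow> fst (h s) = a \<Longrightarrow> pulls h s a < pulls h t a"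
  using pulls_mono[of "Suc s" t h a] by (simp add: pulls_Suc)

text \<open>Each pull of \<open>a\<close> raises the count, so a pull is determined by the number of
  earlier pulls. Sums over rounds can thus be re-indexed by pull counts, which keeps the deviation
  bounds independent of the horizon.\<close>

lemma inj_on_pulls: "inj_on (\<lambda>s. pulls h s a) {s. fst (h s) = a}"
proof (rule inj_onI)
  fix s s'
  assume "s \<in> {s. fst (h s) = a}" "s' \<in> {s. fst (h s) = a}" "pulls h s a = pulls h s' a"
  then show "s = s'"
    using pulls_less[of s s' h a] pulls_less[of s' s h a] by (cases s s' rule: linorder_cases) auto
qed

text \<open>A function of the first \<open>t\<close> rounds factors through the restriction to
  \<open>{0..<t}\<close>, so its measurability carries over to larger index sets, in particular to
  whole trajectories.\<close>

lemma borel_measurable_PiM_local: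
  fixes f :: "history \<Rightarrow> 'b :: topological_space"
  assumes f: "f \<in> borel_measurable (PiM {0..<t} (\<lambda>_. round_space))"
    and local: "\<And>h h'. (\<And>s. s < t \<Longrightarrow> h s = h' s) \<Longrightarrow> f h = f h'"
    and I: "{0..<t} \<subseteq> I"
  shows "f \<in> borel_measurable (PiM I (\<lambda>_. round_space))"
proof -
  have "(\<lambda>h. f (restrict h {0..<t})) \<in> borel_measurable (PiM I (\<lambda>_. round_space))"
    by (rule measurable_compose[OF measurable_restrict_subset[OF I] f])
  moreover have "f (restrict h {0..<t}) = f h" for h
    by (rule local) simp
  ultimately show ?thesis by simp
qed

lemma
  assumes "{0..<t} \<subseteq> I"
  shows measurable_pulls': "(\<lambda>h. real (pulls h t a)) \<in> borel_measurable (PiM I (\<lambda>_. round_space))"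
    and measurable_emp_mean': "(\<lambda>h. emp_mean h t a) \<in> borel_measurable (PiM I (\<lambda>_. round_space))"
    and measurable_best_emp_mean':
      "(\<lambda>h. best_emp_mean K h t) \<in> borel_measurable (PiM I (\<lambda>_. round_space))"
proof -
  show "(\<lambda>h. real (pulls h t a)) \<in> borel_measurable (PiM I (\<lambda>_. round_space))"
    by (rule borel_measurable_PiM_local[OF measurable_pulls _ assms])
       (rule arg_cong[where f=real], rule pulls_cong, simp)
  show "(\<lambda>h. emp_mean h t a) \<in> borel_measurable (PiM I (\<lambda>_. round_space))"
    by (rule borel_measurable_PiM_local[OF measurable_emp_mean _ assms]) (rule emp_mean_cong, simp)
  show "(\<lambda>h. best_emp_mean K h t) \<in> borel_measurable (PiM I (\<lambda>_. round_space))"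
    by (rule borel_measurable_PiM_local[OF measurable_best_emp_mean _ assms])
       (rule best_emp_mean_cong, simp)
qed

section \<open>Exponential supermartingale and Chernoff bound per pull\<close>

context ms_bandit
begin

text \<open>The exponential supermartingale of the rewards of arm \<open>b\<close>, stopped at its \<open>n\<close>-th pull.\<close>

definition stopped_exp :: "nat \<Rightarrow> nat \<Rightarrow> real \<Rightarrow> nat \<Rightarrow> history \<Rightarrow> real" where
  "stopped_exp b n l t h = (\<Prod>s<t. if fst (h s) = b \<and> pulls h s b < n
     then exp (l * (snd (h s) - mean (\<nu> b)) - l\<^sup>2 * \<sigma>\<^sup>2 / 2) else 1)"

lemma stopped_exp_nonneg: "0 \<le> stopped_exp b n l t h"
  unfolding stopped_exp_def by (intro prod_nonneg) auto

lemma stopped_exp_cong: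
  "(\<And>s. s < t \<Longrightarrow> h s = h' s) \<Longrightarrow> stopped_exp b n l t h = stopped_exp b n l t h'"
  unfolding stopped_exp_def
proof (rule prod.cong[OF refl])
  fix s assume *: "\<And>s. s < t \<Longrightarrow> h s = h' s" "s \<in> {..<t}"
  then have "pulls h s b = pulls h' s b"
    by (intro pulls_cong) auto
  with * show "(if fst (h s) = b \<and> pulls h s b < n
      then exp (l * (snd (h s) - mean (\<nu> b)) - l\<^sup>2 * \<sigma>\<^sup>2 / 2) else 1) = (if fst (h' s) = b \<and> pulls h' s b < n
      then exp (l * (snd (h' s) - mean (\<nu> b)) - l\<^sup>2 * \<sigma>\<^sup>2 / 2) else 1)"
    by auto
qed

lemma measurable_stopped_exp:
  assumes "{0..<t} \<subseteq> I"
  shows "stopped_exp b n l t \<in> borel_measurable (PiM I (\<lambda>_. round_space))"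
proof -
  have "(\<lambda>h. if fst (h s) = b \<and> pulls h s b < n
      then exp (l * (snd (h s) - mean (\<nu> b)) - l\<^sup>2 * \<sigma>\<^sup>2 / 2) else 1)
    \<in> borel_measurable (PiM I (\<lambda>_. round_space))" if "s < t" for s
  proof -
    have s: "s \<in> I" "{0..<s} \<subseteq> I"
      using that assms by auto
    have *: "(\<lambda>h. if f h = b \<and> g h < real n then exp (l * (k h - mean (\<nu> b)) - l\<^sup>2 * \<sigma>\<^sup>2 / 2) else 1)
        \<in> borel_measurable M"
      if [measurable]: "f \<in> measurable M (count_space UNIV)" "g \<in> borel_measurable M"
        "k \<in> borel_measurable M"
      for M :: "history measure" and f :: "history \<Rightarrow> nat" and g k :: "history \<Rightarrow> real"
      by measurable
    have "(\<lambda>h. if fst (h s) = b \<and> real (pulls h s b) < real n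
        then exp (l * (snd (h s) - mean (\<nu> b)) - l\<^sup>2 * \<sigma>\<^sup>2 / 2) else 1)
      \<in> borel_measurable (PiM I (\<lambda>_. round_space))"
      by (rule *[OF measurable_round_fst[OF s(1)] measurable_pulls'[OF s(2)] measurable_round_snd[OF s(1)]])
    then show ?thesis by (simp only: of_nat_less_iff)
  qed
  then show ?thesis
    unfolding stopped_exp_def[abs_def] by (intro borel_measurable_prod) (simp only: lessThan_iff)
qed

lemma nn_integral_exp_subgaussian:
  assumes "b \<in> {1..K}"
  shows "(\<integral>\<^sup>+y. ennreal (exp (l * (y - mean (\<nu> b)) - l\<^sup>2 * \<sigma>\<^sup>2 / 2)) \<partial>\<nu> b) \<le> 1"
proof -
  have int: "integrable (\<nu> b) (\<lambda>y. exp (l * (y - mean (\<nu> b))))"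
    and le: "(\<integral>y. exp (l * (y - mean (\<nu> b))) \<partial>\<nu> b) \<le> exp (l\<^sup>2 * \<sigma>\<^sup>2 / 2)"
    using sub[OF assms] by (auto simp: subgaussian_def)
  have "(\<integral>\<^sup>+y. ennreal (exp (l * (y - mean (\<nu> b)) - l\<^sup>2 * \<sigma>\<^sup>2 / 2)) \<partial>\<nu> b)
      = ennreal (\<integral>y. exp (l * (y - mean (\<nu> b))) / exp (l\<^sup>2 * \<sigma>\<^sup>2 / 2) \<partial>\<nu> b)"
    unfolding exp_diff using int by (intro nn_integral_eq_integral) auto
  also have "\<dots> \<le> 1"
    using le by simp
  finally show ?thesis .
qed

text \<open>Given the past, the newest factor has mean at most 1 whichever arm is drawn: by
  sub-Gaussianity for \<open>b\<close> before stopping, and trivially otherwise. Adaptive sampling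
  is therefore harmless.\<close>

lemma nn_integral_stopped_exp:
  assumes b: "b \<in> {1..K}"
  shows "(\<integral>\<^sup>+h. ennreal (stopped_exp b n l t h) \<partial>P) \<le> 1"
proof (induction t)
  case 0
  interpret prob_space P by (rule prob_space_law)
  show ?case by (simp add: stopped_exp_def emeasure_space_1)
next
  case (Suc t)
  let ?Z = "stopped_exp b n l"
  let ?e = "\<lambda>y. exp (l * (y - mean (\<nu> b)) - l\<^sup>2 * \<sigma>\<^sup>2 / 2)"
  have Z: "?Z (Suc t) (h(t := (a, y))) = ?Z t h * (if a = b \<and> pulls h t b < n then ?e y else 1)" for h a y
  proof -
    have "?Z t (h(t := (a, y))) = ?Z t h"
      by (rule stopped_exp_cong) simp
    moreover have "pulls (h(t := (a, y))) t b = pulls h t b"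
      by (rule pulls_cong) simp
    ultimately show ?thesis
      by (simp add: stopped_exp_def)
  qed
  have le: "(\<integral>\<^sup>+y. ennreal (?Z (Suc t) (h(t := (a, y)))) \<partial>\<nu> a) \<le> ennreal (?Z t h)"
    if a: "a \<in> {1..K}" for h a
  proof -
    interpret prob_space "\<nu> a" by (rule prob_\<nu>[OF a])
    note [measurable_cong] = sets_\<nu>[OF a]
    have "(\<integral>\<^sup>+y. ennreal (?Z (Suc t) (h(t := (a, y)))) \<partial>\<nu> a)
      = ennreal (?Z t h) * (\<integral>\<^sup>+y. ennreal (if a = b \<and> pulls h t b < n then ?e y else 1) \<partial>\<nu> a)"
      unfolding Z by (simp add: ennreal_mult' stopped_exp_nonneg nn_integral_cmult)
    also have "\<dots> \<le> ennreal (?Z t h) * 1"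
      using nn_integral_exp_subgaussian[OF b, of l]
      by (intro mult_left_mono) (cases "a = b \<and> pulls h t b < n"; auto simp: emeasure_space_1)+
    finally show ?thesis by simp
  qed
  have "(\<integral>\<^sup>+h. ennreal (?Z (Suc t) h) \<partial>P) = (\<integral>\<^sup>+h. (\<Sum>a\<in>{1..K}. ennreal (q t h a)
      * (\<integral>\<^sup>+y. ennreal (?Z (Suc t) (h(t := (a, y)))) \<partial>\<nu> a)) \<partial>P)"
  proof (rule nn_integral_law_step)
    have [measurable]: "?Z (Suc t) \<in> borel_measurable (PiM {0..<Suc t} (\<lambda>_. round_space))"
      by (rule measurable_stopped_exp) simp
    show "(\<lambda>h. ennreal (?Z (Suc t) h)) \<in> borel_measurable (PiM {0..<Suc t} (\<lambda>_. round_space))"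
      by measurable
  qed (rule arg_cong[where f=ennreal], rule stopped_exp_cong, simp)
  also have "\<dots> \<le> (\<integral>\<^sup>+h. ennreal (?Z t h) \<partial>P)"
  proof (rule nn_integral_mono)
    fix h
    have "(\<Sum>a\<in>{1..K}. ennreal (q t h a) * (\<integral>\<^sup>+y. ennreal (?Z (Suc t) (h(t := (a, y)))) \<partial>\<nu> a))
        \<le> (\<Sum>a\<in>{1..K}. ennreal (q t h a) * ennreal (?Z t h))"
      by (intro sum_mono mult_left_mono le) auto
    also have "\<dots> = ennreal (\<Sum>a\<in>{1..K}. q t h a) * ennreal (?Z t h)"
      by (simp add: sum_distrib_right[symmetric])
    also have "\<dots> \<le> 1 * ennreal (?Z t h)"
      by (intro mult_right_mono) (auto simp: measure_measure_pmf_finite[symmetric])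
    finally show "(\<Sum>a\<in>{1..K}. ennreal (q t h a) * (\<integral>\<^sup>+y. ennreal (?Z (Suc t) (h(t := (a, y)))) \<partial>\<nu> a))
        \<le> ennreal (?Z t h)" by simp
  qed
  finally show ?case using Suc.IH by (rule order.trans)
qed

text \<open>Once \<open>b\<close> has been pulled \<open>n\<close> times all further factors are 1.
  The random time of the pull is thereby replaced by the fixed horizon \<open>T\<close>, at which
  the expectation is controlled for each fixed \<open>n\<close>.\<close>

lemma stopped_exp_at_pull:
  assumes "s \<le> T" "1 \<le> pulls h s b"
  shows "stopped_exp b (pulls h s b) l T h
    = exp (real (pulls h s b) * (l * (emp_mean h s b - mean (\<nu> b)) - l\<^sup>2 * \<sigma>\<^sup>2 / 2))"
proof -
  define n where "n = pulls h s b"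
  let ?e = "\<lambda>r. exp (l * (snd (h r) - mean (\<nu> b)) - l\<^sup>2 * \<sigma>\<^sup>2 / 2)"
  let ?R = "{r. r < s \<and> fst (h r) = b}"
  have "stopped_exp b n l T h = (\<Prod>r\<in>?R. ?e r)"
    unfolding stopped_exp_def
  proof (rule prod.mono_neutral_cong_right)
    show "\<forall>i\<in>{..<T} - ?R. (if fst (h i) = b \<and> pulls h i b < n then ?e i else 1) = 1"
    proof
      fix r assume r: "r \<in> {..<T} - ?R"
      show "(if fst (h r) = b \<and> pulls h r b < n then ?e r else 1) = 1"
      proof (cases "fst (h r) = b")
        case True
        with r have "s \<le> r" by auto
        then have "n \<le> pulls h r b"
          unfolding n_def by (rule pulls_mono)
        then show ?thesis by simp
      qed simp
    qed
  next
    show "?R \<subseteq> {..<T}"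
      using assms by auto
  next
    fix r assume "r \<in> ?R"
    then show "(if fst (h r) = b \<and> pulls h r b < n then ?e r else 1) = ?e r"
      using pulls_less[of r s h b] by (simp add: n_def)
  qed simp
  also have "\<dots> = exp (\<Sum>r\<in>?R. l * (snd (h r) - mean (\<nu> b)) - l\<^sup>2 * \<sigma>\<^sup>2 / 2)"
    by (simp add: exp_sum)
  also have "(\<Sum>r\<in>?R. l * (snd (h r) - mean (\<nu> b)) - l\<^sup>2 * \<sigma>\<^sup>2 / 2)
      = l * (\<Sum>r\<in>?R. snd (h r)) - real n * (l * mean (\<nu> b)) - real n * (l\<^sup>2 * \<sigma>\<^sup>2 / 2)"
    by (simp add: sum_subtractf right_diff_distrib sum_distrib_left n_def pulls_def)
  also have "(\<Sum>r\<in>?R. snd (h r)) = real n * emp_mean h s b"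
    using assms by (simp add: emp_mean_def n_def)
  finally show ?thesis
    by (simp add: n_def algebra_simps)
qed

text \<open>Markov's inequality in pointwise form, summed over the pull count instead of the round:
  for each \<open>n\<close> at most one pull of \<open>b\<close> has exactly \<open>n\<close>
  predecessors, and it costs one Chernoff bound. The sign \<open>\<tau>\<close> selects over- or
  underestimation.\<close>

lemma nn_integral_deviation:
  fixes y :: "nat \<Rightarrow> real" and \<tau> :: real
  assumes b: "b \<in> {1..K}" and \<tau>: "\<tau>\<^sup>2 = 1" and y: "\<And>n. 0 \<le> y n"
  shows "(\<integral>\<^sup>+h. (\<Sum>s<T. if fst (h s) = b \<and> 1 \<le> pulls h s b \<and>
        y (pulls h s b) \<le> \<tau> * (emp_mean h s b - mean (\<nu> b)) then 1 else 0) \<partial>P)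
    \<le> (\<Sum>n\<in>{1..T}. ennreal (exp (- (real n * (y n)\<^sup>2 / (2 * \<sigma>\<^sup>2)))))"
proof -
  \<comment> \<open>The Chernoff tilt: for \<open>z = \<tau> * y n\<close> the exponent
    \<open>l * z - l\<^sup>2 * \<sigma>\<^sup>2 / 2\<close> is largest at
    \<open>l = z / \<sigma>\<^sup>2\<close>, with maximum
    \<open>(y n)\<^sup>2 / (2 * \<sigma>\<^sup>2)\<close>.\<close>
  define l where "l n = \<tau> * y n / \<sigma>\<^sup>2" for n
  define g where "g n h = exp (- (real n * (y n)\<^sup>2 / (2 * \<sigma>\<^sup>2))) * stopped_exp b n (l n) T h" for n h
  have g0: "0 \<le> g n h" for n h
    unfolding g_def using stopped_exp_nonneg by simp
  have [measurable]: "stopped_exp b n l T \<in> borel_measurable P" for n l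
    by (subst measurable_cong_sets[OF sets_law refl]) (rule measurable_stopped_exp, simp)
  have pointwise: "(\<Sum>s<T. if fst (h s) = b \<and> 1 \<le> pulls h s b \<and>
        y (pulls h s b) \<le> \<tau> * (emp_mean h s b - mean (\<nu> b)) then 1 else 0)
      \<le> (\<Sum>n\<in>{1..T}. g n h)" for h
  proof -
    define S where "S = {s. s < T \<and> fst (h s) = b \<and> 1 \<le> pulls h s b \<and>
        y (pulls h s b) \<le> \<tau> * (emp_mean h s b - mean (\<nu> b))}"
    have "1 \<le> g (pulls h s b) h" if s: "s \<in> S" for s
    proof -
      define n where "n = pulls h s b"
      have n: "1 \<le> n" and dev: "y n \<le> \<tau> * (emp_mean h s b - mean (\<nu> b))"
        using s by (auto simp: S_def n_def)
      have "stopped_exp b n (l n) T h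
          = exp (real n * (l n * (emp_mean h s b - mean (\<nu> b)) - (l n)\<^sup>2 * \<sigma>\<^sup>2 / 2))"
        unfolding n_def by (rule stopped_exp_at_pull) (use s in \<open>auto simp: S_def\<close>)
      then have "g n h = exp (real n * (l n * (emp_mean h s b - mean (\<nu> b)) - (l n)\<^sup>2 * \<sigma>\<^sup>2 / 2 - (y n)\<^sup>2 / (2 * \<sigma>\<^sup>2)))"
        by (simp only: g_def mult_exp_exp) (simp add: right_diff_distrib)
      \<comment> \<open>The exponent factors into \<open>y n\<close> and the excess of the deviation
        over \<open>y n\<close>, both nonnegative here.\<close>
      also have "l n * (emp_mean h s b - mean (\<nu> b)) - (l n)\<^sup>2 * \<sigma>\<^sup>2 / 2 - (y n)\<^sup>2 / (2 * \<sigma>\<^sup>2)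
          = y n * (\<tau> * (emp_mean h s b - mean (\<nu> b)) - y n) / \<sigma>\<^sup>2"
        using \<sigma> by (simp add: l_def power_mult_distrib power_divide \<tau>)
          (simp add: field_simps power2_eq_square power4_eq_xxxx)
      finally show ?thesis
        using dev y[of n] by (simp add: n_def)
    qed
    then have "real (card S) \<le> (\<Sum>s\<in>S. g (pulls h s b) h)"
      using sum_mono[of S "\<lambda>_. 1" "\<lambda>s. g (pulls h s b) h"] by simp
    also have "\<dots> = (\<Sum>n\<in>(\<lambda>s. pulls h s b) ` S. g n h)"
      by (rule sum.reindex_cong[symmetric, where l="\<lambda>s. pulls h s b", OF inj_on_subset[OF inj_on_pulls[of h b]]])
         (auto simp: S_def)
    also have "\<dots> \<le> (\<Sum>n\<in>{1..T}. g n h)"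
      using g0 order.trans[OF pulls_le less_imp_le] by (intro sum_mono2) (auto simp: S_def)
    finally show ?thesis
      by (simp add: S_def sum.If_cases Int_def lessThan_def)
  qed
  have "(\<integral>\<^sup>+h. (\<Sum>s<T. if fst (h s) = b \<and> 1 \<le> pulls h s b \<and>
        y (pulls h s b) \<le> \<tau> * (emp_mean h s b - mean (\<nu> b)) then 1 else 0) \<partial>P)
      \<le> (\<integral>\<^sup>+h. ennreal (\<Sum>n\<in>{1..T}. g n h) \<partial>P)"
  proof (rule nn_integral_mono)
    fix h :: history
    have "(\<Sum>s<T. if fst (h s) = b \<and> 1 \<le> pulls h s b \<and>
        y (pulls h s b) \<le> \<tau> * (emp_mean h s b - mean (\<nu> b)) then 1 else 0 :: ennreal)
      = ennreal (\<Sum>s<T. if fst (h s) = b \<and> 1 \<le> pulls h s b \<and>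
        y (pulls h s b) \<le> \<tau> * (emp_mean h s b - mean (\<nu> b)) then 1 else 0)"
      by (subst sum_ennreal[symmetric]) (simp, intro sum.cong, auto)
    also have "\<dots> \<le> ennreal (\<Sum>n\<in>{1..T}. g n h)"
      using pointwise by (rule ennreal_leI)
    finally show "(\<Sum>s<T. if fst (h s) = b \<and> 1 \<le> pulls h s b \<and>
        y (pulls h s b) \<le> \<tau> * (emp_mean h s b - mean (\<nu> b)) then 1 else 0 :: ennreal)
      \<le> ennreal (\<Sum>n\<in>{1..T}. g n h)" .
  qed
  also have "\<dots> = (\<Sum>n\<in>{1..T}. ennreal (exp (- (real n * (y n)\<^sup>2 / (2 * \<sigma>\<^sup>2))))
      * (\<integral>\<^sup>+h. ennreal (stopped_exp b n (l n) T h) \<partial>P))"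
  proof -
    have "(\<integral>\<^sup>+h. ennreal (\<Sum>n\<in>{1..T}. g n h) \<partial>P) = (\<integral>\<^sup>+h. (\<Sum>n\<in>{1..T}.
        ennreal (exp (- (real n * (y n)\<^sup>2 / (2 * \<sigma>\<^sup>2)))) * ennreal (stopped_exp b n (l n) T h)) \<partial>P)"
      by (intro nn_integral_cong, subst sum_ennreal[symmetric])
         (rule g0, simp add: g_def ennreal_mult')
    also have "\<dots> = (\<Sum>n\<in>{1..T}. ennreal (exp (- (real n * (y n)\<^sup>2 / (2 * \<sigma>\<^sup>2))))
      * (\<integral>\<^sup>+h. ennreal (stopped_exp b n (l n) T h) \<partial>P))"
      by (subst nn_integral_sum) (simp_all add: nn_integral_cmult)
    finally show ?thesis .
  qed
  also have "\<dots> \<le> (\<Sum>n\<in>{1..T}. ennreal (exp (- (real n * (y n)\<^sup>2 / (2 * \<sigma>\<^sup>2)))) * 1)"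
    by (intro sum_mono mult_left_mono nn_integral_stopped_exp b) auto
  finally show ?thesis by simp
qed

end

section \<open>Exponential sums and deviation levels\<close>

text \<open>Telescoping: by \<open>1 + \<theta> \<le> exp \<theta>\<close> each term is at most the
  increment of \<open>(1 - exp (- (real n * \<theta>))) / \<theta>\<close>.\<close>

lemma sum_exp_le:
  fixes \<theta> :: real
  assumes "\<theta> > 0"
  shows "(\<Sum>n\<in>{1..T}. exp (- (real n * \<theta>))) \<le> 1 / \<theta>"
proof -
  have "(\<Sum>n\<in>{1..T}. exp (- (real n * \<theta>))) \<le> (1 - exp (- (real T * \<theta>))) / \<theta>"
  proof (induction T)
    case (Suc T)
    have "exp (- (real (Suc T) * \<theta>)) * (1 + \<theta>) \<le> exp (- (real (Suc T) * \<theta>)) * exp \<theta>"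
      using assms by (intro mult_left_mono) auto
    also have "\<dots> = exp (- (real T * \<theta>))"
      by (simp add: mult_exp_exp algebra_simps)
    finally have "exp (- (real (Suc T) * \<theta>)) \<le> (exp (- (real T * \<theta>)) - exp (- (real (Suc T) * \<theta>))) / \<theta>"
      using assms by (simp add: field_simps)
    with Suc.IH show ?case
      using assms by (simp add: diff_divide_distrib)
  qed simp
  also have "\<dots> \<le> 1 / \<theta>"
    using assms by (intro divide_right_mono) auto
  finally show ?thesis .
qed

text \<open>By telescoping: \<open>- (2 / \<beta>\<^sup>2) (1 + \<beta> \<surd>v) exp (- \<beta> \<surd>v)\<close> is an antiderivative of
  \<open>exp (- \<beta> \<surd>v)\<close>.\<close>

lemma sum_exp_sqrt_le:
  fixes \<beta> :: real
  assumes "\<beta> > 0"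
  shows "(\<Sum>n\<in>{1..T}. exp (- (\<beta> * sqrt (real n)))) \<le> 2 / \<beta>\<^sup>2"
proof -
  define g where "g n = (1 + \<beta> * sqrt (real n)) * exp (- (\<beta> * sqrt (real n)))" for n
  have step: "exp (- (\<beta> * sqrt (real (Suc n)))) * \<beta>\<^sup>2 / 2 \<le> g n - g (Suc n)" for n
  proof -
    define p where "p = \<beta> * sqrt (real n)"
    define d where "d = \<beta> * sqrt (real (Suc n)) - p"
    have p: "0 \<le> p" and d: "0 \<le> d"
      using assms by (auto simp: p_def d_def)
    have "p\<^sup>2 = \<beta>\<^sup>2 * real n" and "(p + d)\<^sup>2 = \<beta>\<^sup>2 * real (Suc n)"
      by (auto simp: p_def d_def power_mult_distrib)
    \<comment> \<open>Consecutive squares differ by \<open>\<beta>\<^sup>2\<close>, so the claim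
      concerns \<open>p\<close> and \<open>d\<close> only. A second-order Taylor bound for
      \<open>exp d\<close> and a first-order one for \<open>p * exp d\<close> produce exactly
      \<open>\<beta>\<^sup>2 / 2\<close>.\<close>
    then have \<beta>: "\<beta>\<^sup>2 = 2 * p * d + d\<^sup>2"
      by (simp add: power2_sum algebra_simps)
    have "1 + d + d\<^sup>2 / 2 \<le> exp d"
      using exp_lower_Taylor_quadratic[OF d] .
    moreover have "p * (1 + d) \<le> p * exp d"
      using p by (intro mult_left_mono) auto
    ultimately have "\<beta>\<^sup>2 / 2 + (1 + p + d) \<le> (1 + p) * exp d"
      unfolding \<beta> by (simp add: field_simps)
    then have "exp (- (p + d)) * (\<beta>\<^sup>2 / 2 + (1 + p + d)) \<le> exp (- (p + d)) * ((1 + p) * exp d)"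
      by (intro mult_left_mono) auto
    moreover have "exp (- (p + d)) * exp d = exp (- p)"
      by (simp add: mult_exp_exp)
    ultimately have "exp (- (p + d)) * \<beta>\<^sup>2 / 2 \<le> (1 + p) * exp (- p) - (1 + (p + d)) * exp (- (p + d))"
      by (simp add: algebra_simps)
    then show ?thesis
      by (simp add: g_def d_def p_def)
  qed
  have "(\<Sum>n\<in>{1..T}. exp (- (\<beta> * sqrt (real n)))) * \<beta>\<^sup>2 / 2 \<le> 1 - g T"
  proof (induction T)
    case (Suc T)
    with step[of T] show ?case
      by (simp add: distrib_right add_divide_distrib)
  qed (simp add: g_def)
  also have "\<dots> \<le> 1"
    using assms by (simp add: g_def)
  finally show ?thesis
    using assms by (simp add: field_simps)
qed

text \<open>Expanding the square leaves three terms. The last equals \<open>j\<close>, the mixed one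
  is \<open>\<beta> * sqrt n\<close>, and for \<open>j > 0\<close> the first is dropped, so the sum
  is at most \<open>2 / \<beta>\<^sup>2 = 1 / (2 * j * \<theta>)\<close> times
  \<open>exp (- j)\<close>. For \<open>j = 0\<close> only the first term is present.\<close>

lemma sum_exp_shifted_deviation_le:
  fixes \<epsilon> \<sigma> :: real and j :: nat
  assumes "\<epsilon> > 0" "\<sigma> > 0"
  defines "\<theta> \<equiv> \<epsilon>\<^sup>2 / (2 * \<sigma>\<^sup>2)"
  shows "(\<Sum>n\<in>{1..T}. exp (- (real n * (\<epsilon> + sqrt (2 * \<sigma>\<^sup>2 * real j / real n))\<^sup>2 / (2 * \<sigma>\<^sup>2))))
    \<le> exp (- real j) * ((if j = 0 then 1 else 1 / (2 * real j)) / \<theta>)"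
proof (cases "j = 0")
  case True
  then show ?thesis
    using sum_exp_le[of \<theta> T] assms by simp
next
  case False
  have \<theta>: "\<theta> > 0"
    using assms by simp
  define \<beta> where "\<beta> = 2 * sqrt (real j * \<theta>)"
  have \<beta>: "\<beta> > 0" "\<beta>\<^sup>2 = 4 * (real j * \<theta>)"
    using False \<theta> by (auto simp: \<beta>_def power_mult_distrib)
  have le: "exp (- (real n * (\<epsilon> + sqrt (2 * \<sigma>\<^sup>2 * real j / real n))\<^sup>2 / (2 * \<sigma>\<^sup>2)))
      \<le> exp (- real j) * exp (- (\<beta> * sqrt (real n)))" if n: "n \<in> {1..T}" for n
  proof -
    define z where "z = sqrt (2 * \<sigma>\<^sup>2 * real j / real n)"
    have z2: "z\<^sup>2 = 2 * \<sigma>\<^sup>2 * real j / real n"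
      by (simp add: z_def)
    have "real n * (2 * \<epsilon> * z) / (2 * \<sigma>\<^sup>2) = \<beta> * sqrt (real n)"
    proof (rule power2_eq_imp_eq)
      show "(real n * (2 * \<epsilon> * z) / (2 * \<sigma>\<^sup>2))\<^sup>2 = (\<beta> * sqrt (real n))\<^sup>2"
        using n assms by (simp add: power_mult_distrib power_divide z2 \<beta>(2) \<theta>_def)
          (simp add: field_simps power2_eq_square power4_eq_xxxx)
    qed (use assms \<beta> in \<open>auto simp: z_def\<close>)
    moreover have "real n * z\<^sup>2 / (2 * \<sigma>\<^sup>2) = real j"
      using n assms by (simp add: z2)
    moreover have "0 \<le> real n * \<epsilon>\<^sup>2 / (2 * \<sigma>\<^sup>2)"
      by simp
    moreover have "real n * (\<epsilon> + z)\<^sup>2 / (2 * \<sigma>\<^sup>2)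
        = real n * \<epsilon>\<^sup>2 / (2 * \<sigma>\<^sup>2) + real n * (2 * \<epsilon> * z) / (2 * \<sigma>\<^sup>2) + real n * z\<^sup>2 / (2 * \<sigma>\<^sup>2)"
      by (simp add: power2_sum distrib_left add_divide_distrib)
    ultimately have "real j + \<beta> * sqrt (real n) \<le> real n * (\<epsilon> + z)\<^sup>2 / (2 * \<sigma>\<^sup>2)"
      by linarith
    then show ?thesis
      by (simp add: z_def mult_exp_exp)
  qed
  have "(\<Sum>n\<in>{1..T}. exp (- (real n * (\<epsilon> + sqrt (2 * \<sigma>\<^sup>2 * real j / real n))\<^sup>2 / (2 * \<sigma>\<^sup>2))))
      \<le> exp (- real j) * (\<Sum>n\<in>{1..T}. exp (- (\<beta> * sqrt (real n))))"
    unfolding sum_distrib_left by (intro sum_mono le)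
  also have "\<dots> \<le> exp (- real j) * (2 / \<beta>\<^sup>2)"
    by (intro mult_left_mono sum_exp_sqrt_le \<beta>) auto
  finally show ?thesis
    using False by (simp add: \<beta>(2) mult.commute)
qed

text \<open>For \<open>D \<le> 1\<close> the inflation is at most \<open>1 + k\<close>, and
  \<open>exp (- k) * (1 + k)\<close> decreases on the nonnegative reals.\<close>

lemma inflated_exp_decreasing:
  fixes D k L :: real
  assumes "0 \<le> D" "D \<le> 1" "0 \<le> L" "L \<le> k"
  shows "exp (- k) * (1 + D * k) \<le> exp (- L) * (1 + L)"
proof -
  have "1 + D * k \<le> 1 + k"
    using assms mult_right_mono[of D 1 k] by simp
  also have "\<dots> \<le> (1 + L) * (1 + (k - L))"
    using assms mult_nonneg_nonneg[of L "k - L"] by (simp add: algebra_simps)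
  also have "\<dots> \<le> (1 + L) * exp (k - L)"
    using assms exp_ge_add_one_self[of "k - L"] by (intro mult_left_mono) auto
  finally have "exp (- k) * (1 + D * k) \<le> exp (- k) * ((1 + L) * exp (k - L))"
    by (intro mult_left_mono) auto
  also have "\<dots> = exp (- L) * (1 + L)"
    by (simp add: exp_diff exp_minus field_simps)
  finally show ?thesis .
qed

text \<open>Monotonicity again, now with \<open>D\<close> kept:
  \<open>exp (- k) * (1 + D * k)\<close> decreases because \<open>D \<le> 1\<close>. The quotient
  form preserves the denominator \<open>1 + D * k\<close> needed for summing over levels.\<close>

lemma inflated_exp_ratio:
  fixes D k k' :: real
  assumes "0 \<le> D" "D \<le> 1" "0 \<le> k'" "k' \<le> k"
  shows "1 \<le> exp k / (1 + D * k) * (exp (- k') * (1 + D * k'))"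
proof -
  have "D * (k - k') \<le> k - k'"
    using assms mult_right_mono[of D 1 "k - k'"] by simp
  then have "1 + D * k \<le> (1 + D * k') * (1 + (k - k'))"
    using assms mult_nonneg_nonneg[of "D * k'" "k - k'"] by (simp add: algebra_simps)
  also have "\<dots> \<le> (1 + D * k') * exp (k - k')"
    using assms exp_ge_add_one_self[of "k - k'"] by (intro mult_left_mono) auto
  finally have "1 \<le> (1 + D * k') * exp (k - k') / (1 + D * k)"
    using assms add_pos_nonneg[of 1 "D * k"] by simp
  then show ?thesis
    by (simp add: exp_diff exp_minus field_simps)
qed

text \<open>The extra factor \<open>1 + ln (1 + x)\<close> in the threshold is there to cancel the
  inflation: \<open>L \<le> 2 * ln (1 + x)\<close>, hence \<open>1 + L\<close> is at most twice that
  factor.\<close>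

lemma exp_log_threshold_le:
  fixes x :: real
  assumes "x \<ge> 1"
  defines "L \<equiv> ln (x * (1 + ln (1 + x)))"
  shows "exp (- L) * (1 + L) \<le> 2 / x"
proof -
  have l: "0 \<le> ln (1 + x)"
    using assms by simp
  have "L = ln x + ln (1 + ln (1 + x))"
    unfolding L_def using assms(1) l by (intro ln_mult_pos) linarith+
  also have "\<dots> \<le> ln (1 + x) + ln (1 + x)"
    using assms(1) l ln_add_one_self_le_self[of x] by (intro add_mono ln_mono) linarith+
  finally have "1 + L \<le> 2 * (1 + ln (1 + x))"
    by simp
  moreover have "exp (- L) = 1 / (x * (1 + ln (1 + x)))"
  proof -
    have "0 < x * (1 + ln (1 + x))"
      using assms(1) l by (intro mult_pos_pos) linarith+
    then show ?thesis
      unfolding L_def exp_minus by (subst exp_ln) (simp_all add: inverse_eq_divide)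
  qed
  moreover have "1 / (x * (1 + ln (1 + x))) * (2 * (1 + ln (1 + x))) = 2 / x"
  proof -
    have "1 / (x * z) * (2 * z) = 2 / x" if "0 < z" for z
      using that assms(1) by (simp add: field_simps)
    moreover have "0 < 1 + ln (1 + x)"
      using l by linarith
    ultimately show ?thesis .
  qed
  ultimately show ?thesis
    using assms l mult_left_mono[of "1 + L" "2 * (1 + ln (1 + x))" "1 / (x * (1 + ln (1 + x)))"]
    by simp
qed

text \<open>Discrete layer-cake decomposition, along the integer levels below \<open>k\<close>.\<close>

lemma exp_div_le_suminf_levels:
  fixes D k :: real
  assumes "0 \<le> D" "0 \<le> k"
  shows "ennreal (exp k / (1 + D * k))
    \<le> (\<Sum>j. ennreal (exp (real j + 1) / (1 + D * real j)) * (if real j \<le> k then 1 else 0))"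
proof -
  \<comment> \<open>The single level \<open>j\<close> just below \<open>k\<close> suffices: the
    numerator is rounded up to \<open>j + 1\<close>, the denominator down to
    \<open>j\<close>.\<close>
  define j where "j = nat \<lfloor>k\<rfloor>"
  have j: "real j \<le> k" "k \<le> real j + 1"
    using assms unfolding j_def by linarith+
  have "exp k / (1 + D * k) \<le> exp (real j + 1) / (1 + D * real j)"
    using j assms by (intro frac_le) (auto intro!: mult_left_mono add_pos_nonneg)
  then have "ennreal (exp k / (1 + D * k))
      \<le> ennreal (exp (real j + 1) / (1 + D * real j)) * (if real j \<le> k then 1 else 0)"
    using j by (simp add: ennreal_leI)
  also have "\<dots> \<le> (\<Sum>j. ennreal (exp (real j + 1) / (1 + D * real j)) * (if real j \<le> k then 1 else 0))"
    using sum_le_suminf[OF summableI, of "{j}" "\<lambda>j. ennreal (exp (real j + 1) / (1 + D * real j)) * (if real j \<le> k then 1 else 0)"]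
    by simp
  finally show ?thesis .
qed

lemma summable_inverse_square_Suc: "summable (\<lambda>j. 1 / real (Suc j) ^ 2)"
  using inverse_power_summable[of 2, where 'a=real] by (subst summable_Suc_iff) (simp add: inverse_eq_divide)

text \<open>Level 0 contributes \<open>exp 1\<close>; level \<open>j > 0\<close> contributes at most
  \<open>exp 1 / (2 * D * j\<^sup>2)\<close>, using \<open>1 + D * j \<ge> D * j\<close>.\<close>

definition level_const :: "real \<Rightarrow> real" where
  "level_const D = exp 1 * (1 + (\<Sum>j. 1 / real (Suc j) ^ 2) / (2 * D))"

lemma level_const_pos:
  assumes "0 < D"
  shows "0 < level_const D"
proof -
  have "0 \<le> (\<Sum>j. 1 / real (Suc j) ^ 2)"
    by (rule suminf_nonneg[OF summable_inverse_square_Suc]) simp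
  with assms show ?thesis
    unfolding level_const_def by (intro mult_pos_pos add_pos_nonneg) auto
qed

text \<open>The factors \<open>exp j\<close> and \<open>exp (- j)\<close> cancel. The remaining
  \<open>1 / (2 * j)\<close> alone would give a harmonic series; the denominator
  \<open>1 + D * j\<close> turns it into a convergent one.\<close>

lemma suminf_levels_le:
  fixes D \<theta> :: real
  assumes "0 < D" "0 < \<theta>"
  shows "(\<Sum>j. ennreal (exp (real j + 1) / (1 + D * real j))
      * ennreal (exp (- real j) * ((if j = 0 then 1 else 1 / (2 * real j)) / \<theta>)))
    \<le> ennreal (level_const D / \<theta>)"
proof -
  define S where "S = (\<Sum>j. 1 / real (Suc j) ^ 2)"
  define v where "v j = (case j of 0 \<Rightarrow> exp 1 / \<theta> | Suc i \<Rightarrow> exp 1 / (2 * D * \<theta>) * (1 / real (Suc i) ^ 2))" for j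
  have sums: "(\<lambda>i. v (Suc i)) sums (exp 1 / (2 * D * \<theta>) * S)"
    unfolding v_def S_def nat.case by (intro sums_mult summable_sums summable_inverse_square_Suc)
  then have "v sums (exp 1 / (2 * D * \<theta>) * S + v 0)"
    by (subst (asm) sums_Suc_iff) simp
  moreover have "exp 1 / (2 * D * \<theta>) * S + v 0 = level_const D / \<theta>"
    using assms by (simp add: v_def level_const_def S_def field_simps)
  ultimately have sv: "v sums (level_const D / \<theta>)"
    by simp
  have v0: "0 \<le> v j" for j
    using assms by (auto simp: v_def split: nat.split)
  have "(\<Sum>j. ennreal (exp (real j + 1) / (1 + D * real j))
      * ennreal (exp (- real j) * ((if j = 0 then 1 else 1 / (2 * real j)) / \<theta>))) \<le> (\<Sum>j. ennreal (v j))"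
  proof (rule suminf_le)
    fix j
    have "exp (real j + 1) / (1 + D * real j) * (exp (- real j) * ((if j = 0 then 1 else 1 / (2 * real j)) / \<theta>))
      = exp 1 / (1 + D * real j) * ((if j = 0 then 1 else 1 / (2 * real j)) / \<theta>)"
      by (simp add: exp_add exp_minus)
    also have "\<dots> \<le> v j"
    proof (cases j)
      case (Suc i)
      have "exp 1 / (1 + D * real j) * (1 / (2 * real j) / \<theta>) \<le> exp 1 / (D * real j) * (1 / (2 * real j) / \<theta>)"
        using assms Suc by (intro mult_right_mono divide_left_mono) (auto intro!: mult_pos_pos add_pos_nonneg)
      also have "\<dots> = v j"
        using assms Suc by (simp add: v_def power2_eq_square field_simps)
      finally show ?thesis
        using Suc by simp
    qed (simp add: v_def)
    finally have "exp (real j + 1) / (1 + D * real j) * (exp (- real j) * ((if j = 0 then 1 else 1 / (2 * real j)) / \<theta>)) \<le> v j" .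
    then show "ennreal (exp (real j + 1) / (1 + D * real j))
      * ennreal (exp (- real j) * ((if j = 0 then 1 else 1 / (2 * real j)) / \<theta>)) \<le> ennreal (v j)"
      using assms by (subst ennreal_mult''[symmetric]) (auto intro: ennreal_leI)
  qed auto
  also have "\<dots> = ennreal (level_const D / \<theta>)"
    using sv v0 by (subst suminf_ennreal2) (auto simp: sums_iff)
  finally show ?thesis .
qed

section \<open>Sampling probabilities\<close>

context ms_bandit
begin

abbreviation "w n h \<equiv> ms_weight B C D \<sigma> K (Suc n) h"
abbreviation "\<kappa> n h a \<equiv> real (pulls h n a) * (emp_gap K h n a)\<^sup>2 / (2 * \<sigma>\<^sup>2)"

lemma emp_mean_le_best: "a \<in> {1..K} \<Longrightarrow> emp_mean h n a \<le> best_emp_mean K h n"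
  unfolding best_emp_mean_def by (intro Max_ge) auto

lemma weight_best:
  assumes "emp_mean h n a = best_emp_mean K h n"
  shows "w n h a = B * (1 + C * ln (1 + ln (real (Suc n) / real (pulls h n a))))"
    and "1 \<le> w n h a"
proof -
  show eq: "w n h a = B * (1 + C * ln (1 + ln (real (Suc n) / real (pulls h n a))))"
    using assms by (simp add: ms_weight_def Let_def)
  \<comment> \<open>With no pull yet the quotient is 0 by convention, and \<open>ln 0\<close> is
    nonnegative.\<close>
  have "0 \<le> ln (real (Suc n) / real (pulls h n a))"
  proof (cases "pulls h n a = 0")
    case False
    then have "1 \<le> real (Suc n) / real (pulls h n a)"
      using pulls_le[of h n a] by (simp add: field_simps)
    then show ?thesis by simp
  qed simp
  then have "0 \<le> C * ln (1 + ln (real (Suc n) / real (pulls h n a)))"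
    using C by (intro mult_nonneg_nonneg) auto
  then show "1 \<le> w n h a"
    unfolding eq using B mult_mono[of 1 B 1] by (simp add: mult_ge1_I)
qed

lemma weight_not_best:
  assumes "emp_mean h n a \<noteq> best_emp_mean K h n"
  shows "w n h a = exp (- \<kappa> n h a) * (1 + D * \<kappa> n h a)"
proof -
  have "0 \<le> D * \<kappa> n h a"
    using D by simp
  then have "exp (ln (1 + D * \<kappa> n h a)) = 1 + D * \<kappa> n h a"
    by (intro exp_ln) linarith
  then show ?thesis
    using assms by (simp add: ms_weight_def Let_def exp_diff exp_minus exp_add[symmetric] field_simps)
qed

lemma weight_pos: "0 < w n h a"
  using ms_weight_pos[of B C D \<sigma> "Suc n" K h a] B C D \<sigma> by simp

text \<open>Some arm attains the best empirical mean and has weight at least 1. Hence no sampling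
  probability exceeds its weight.\<close>

lemma sum_weight_ge_1: "1 \<le> (\<Sum>a\<in>{1..K}. w n h a)"
proof -
  have "best_emp_mean K h n \<in> (\<lambda>b. emp_mean h n b) ` {1..K}"
    unfolding best_emp_mean_def using K by (intro Max_in) auto
  then obtain a where a: "a \<in> {1..K}" "emp_mean h n a = best_emp_mean K h n"
    by auto
  have "1 \<le> w n h a"
    by (rule weight_best(2)[OF a(2)])
  also have "\<dots> \<le> (\<Sum>a\<in>{1..K}. w n h a)"
    using weight_pos a(1) by (intro member_le_sum) (auto simp: less_imp_le)
  finally show ?thesis .
qed

lemma q_eq:
  assumes "K \<le> n" "a \<in> {1..K}"
  shows "q n h a = w n h a / (\<Sum>b\<in>{1..K}. w n h b)"
  using assms B C D \<sigma> K by (subst pmf_ms_arm) (auto simp: ms_prob_def)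

lemma q_le_of_large_gap:
  assumes "K \<le> n" "a \<in> {1..K}" "0 < emp_gap K h n a" "0 \<le> L" "L \<le> \<kappa> n h a"
  shows "q n h a \<le> exp (- L) * (1 + L)"
proof -
  have "q n h a \<le> w n h a"
    unfolding q_eq[OF assms(1,2)] using sum_weight_ge_1[of n h] weight_pos[of n h a]
    by (simp add: divide_le_eq mult_le_cancel_left1)
  also have "\<dots> = exp (- \<kappa> n h a) * (1 + D * \<kappa> n h a)"
    using assms by (intro weight_not_best) (auto simp: emp_gap_def)
  also have "\<dots> \<le> exp (- L) * (1 + L)"
    using D assms by (intro inflated_exp_decreasing) auto
  finally show ?thesis .
qed

text \<open>Both probabilities share the normaliser, so it is enough to compare weights. As
  \<open>m\<close> bounds all empirical means, \<open>b\<close> lags the leader by at most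
  \<open>m - emp_mean h n b\<close>, which bounds its weight from below.\<close>

lemma q_le_q_underestimated:
  assumes "K \<le> n" "a \<in> {1..K}" "b \<in> {1..K}" "w n h a \<le> W" "best_emp_mean K h n \<le> m"
  defines "k \<equiv> real (pulls h n b) * (m - emp_mean h n b)\<^sup>2 / (2 * \<sigma>\<^sup>2)"
  shows "q n h a \<le> W * (exp k / (1 + D * k)) * q n h b"
proof -
  have k: "0 \<le> k"
    by (simp add: k_def)
  \<comment> \<open>If \<open>b\<close> is empirically best, its weight is at least 1 and the ratio
    bound at \<open>k' = 0\<close> suffices; otherwise its weight has the exponential form.\<close>
  have "1 \<le> exp k / (1 + D * k) * w n h b"
  proof (cases "emp_mean h n b = best_emp_mean K h n")
    case True
    have "1 \<le> exp k / (1 + D * k)"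
      using inflated_exp_ratio[of D 0 k] D k by simp
    with weight_best(2)[OF True] show ?thesis
      using mult_mono[of 1 "exp k / (1 + D * k)" 1 "w n h b"] by simp
  next
    case False
    have "\<kappa> n h b \<le> k"
      unfolding k_def using assms emp_mean_le_best[of b h n]
      by (intro divide_right_mono mult_left_mono power_mono) (auto simp: emp_gap_def)
    then show ?thesis
      unfolding weight_not_best[OF False] using D by (intro inflated_exp_ratio) auto
  qed
  then have "W * 1 \<le> W * (exp k / (1 + D * k) * w n h b)"
    using assms(4) weight_pos[of n h a] by (intro mult_left_mono) auto
  then have "w n h a \<le> W * (exp k / (1 + D * k)) * w n h b"
    using assms(4) by (simp add: mult.assoc)
  then have "w n h a / (\<Sum>b\<in>{1..K}. w n h b) \<le> W * (exp k / (1 + D * k)) * w n h b / (\<Sum>b\<in>{1..K}. w n h b)"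
    using sum_weight_ge_1[of n h] by (intro divide_right_mono) auto
  then show ?thesis
    unfolding q_eq[OF assms(1,2)] q_eq[OF assms(1,3)] by simp
qed

text \<open>Source of the iterated logarithm: after \<open>u\<close> pulls the ratio of round to
  pull count is at most \<open>real T / u\<close>. An arm that is not empirically best has weight at
  most 1.\<close>

lemma weight_le:
  assumes "n < T" "0 < u" "u \<le> real (pulls h n a)" "real T / u \<le> x" "1 \<le> x"
  shows "w n h a \<le> B * (1 + ln (1 + ln x))"
proof (cases "emp_mean h n a = best_emp_mean K h n")
  case True
  let ?r = "real (Suc n) / real (pulls h n a)"
  have N: "0 < real (pulls h n a)"
    using assms by linarith
  have "1 \<le> ?r"
    using N pulls_le[of h n a] by (simp add: field_simps)
  have "?r \<le> real T / u"
    using assms N by (intro frac_le) auto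
  with assms(4) have "ln ?r \<le> ln x"
    using \<open>1 \<le> ?r\<close> by (intro ln_mono) auto
  moreover have r: "0 \<le> ln ?r"
    using \<open>1 \<le> ?r\<close> by (rule ln_ge_zero)
  ultimately have l: "ln (1 + ln ?r) \<le> ln (1 + ln x)"
    by (intro ln_mono) linarith+
  have l0: "0 \<le> ln (1 + ln ?r)"
    using r by (intro ln_ge_zero) linarith
  have "C * ln (1 + ln ?r) \<le> 1 * ln (1 + ln ?r)"
    using C l0 by (intro mult_right_mono) auto
  with l have "1 + C * ln (1 + ln ?r) \<le> 1 + ln (1 + ln x)"
    by linarith
  then show ?thesis
    unfolding weight_best(1)[OF True] using B by (intro mult_left_mono) auto
next
  case False
  have "w n h a \<le> exp (- 0) * (1 + 0)"
    unfolding weight_not_best[OF False] using D by (intro inflated_exp_decreasing) auto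
  also have "\<dots> \<le> B * (1 + ln (1 + ln x))"
    using B assms ln_ge_zero[of x] by (simp add: mult_ge1_I)
  finally show ?thesis .
qed

end

section \<open>Expected numbers of pulls\<close>

context ms_bandit
begin

lemma measurable_arm:
  "s \<in> I \<Longrightarrow> (\<lambda>h. if fst (h s) = a then 1 else 0 :: ennreal) \<in> borel_measurable (PiM I (\<lambda>_. round_space))"
  by (rule measurable_compose[OF measurable_round_fst, where g="\<lambda>i. if i = a then 1 else 0"]) auto

lemma measurable_arm_law: "(\<lambda>h. if fst (h s) = a then 1 else 0 :: ennreal) \<in> borel_measurable P"
  by (subst measurable_cong_sets[OF sets_law refl]) (rule measurable_arm, simp)

text \<open>Against a factor known from the past, the indicator of an arm and its sampling
  probability are interchangeable. The charging argument uses this in both directions.\<close>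

lemma nn_integral_arm:
  fixes g :: "history \<Rightarrow> ennreal"
  assumes a: "a \<in> {1..K}"
    and g: "g \<in> borel_measurable (PiM {0..<n} (\<lambda>_. round_space))"
    and local: "\<And>h h'. (\<And>s. s < n \<Longrightarrow> h s = h' s) \<Longrightarrow> g h = g h'"
  shows "(\<integral>\<^sup>+h. g h * (if fst (h n) = a then 1 else 0) \<partial>P) = (\<integral>\<^sup>+h. g h * ennreal (q n h a) \<partial>P)"
proof -
  have "(\<integral>\<^sup>+h. g h * (if fst (h n) = a then 1 else 0) \<partial>P) = (\<integral>\<^sup>+h. (\<Sum>a'\<in>{1..K}. ennreal (q n h a')
      * (\<integral>\<^sup>+y. g (h(n := (a', y))) * (if fst ((h(n := (a', y))) n) = a then 1 else 0) \<partial>\<nu> a')) \<partial>P)"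
  proof (rule nn_integral_law_step)
    show "(\<lambda>h. g h * (if fst (h n) = a then 1 else 0)) \<in> borel_measurable (PiM {0..<Suc n} (\<lambda>_. round_space))"
      by (intro borel_measurable_times_ennreal borel_measurable_PiM_local[OF g local] measurable_arm) auto
    show "g h * (if fst (h n) = a then 1 else 0) = g h' * (if fst (h' n) = a then 1 else 0)"
      if "\<And>i. i \<le> n \<Longrightarrow> h i = h' i" for h h'
      using local[of h h'] that by simp
  qed
  also have "\<dots> = (\<integral>\<^sup>+h. g h * ennreal (q n h a) \<partial>P)"
  proof (rule nn_integral_cong)
    fix h
    have "(\<integral>\<^sup>+y. g (h(n := (a', y))) * (if fst ((h(n := (a', y))) n) = a then 1 else 0) \<partial>\<nu> a')
        = (if a' = a then g h else 0)" if "a' \<in> {1..K}" for a'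
    proof -
      have "g (h(n := (a', y))) = g h" for y
        by (rule local) simp
      then show ?thesis
        using prob_space.emeasure_space_1[OF prob_\<nu>[OF that]] by simp
    qed
    then have "(\<Sum>a'\<in>{1..K}. ennreal (q n h a')
        * (\<integral>\<^sup>+y. g (h(n := (a', y))) * (if fst ((h(n := (a', y))) n) = a then 1 else 0) \<partial>\<nu> a'))
      = (\<Sum>a'\<in>{1..K}. if a' = a then ennreal (q n h a) * g h else 0)"
      by (intro sum.cong) auto
    also have "\<dots> = g h * ennreal (q n h a)"
      using a by (simp add: mult.commute)
    finally show "(\<Sum>a'\<in>{1..K}. ennreal (q n h a')
        * (\<integral>\<^sup>+y. g (h(n := (a', y))) * (if fst ((h(n := (a', y))) n) = a then 1 else 0) \<partial>\<nu> a'))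
      = g h * ennreal (q n h a)" .
  qed
  finally show ?thesis .
qed

text \<open>The initial rounds make every later empirical mean an average of at least one reward,
  and the range of the arms lets a sum over \<open>{1..K}\<close> exhaust the regret.\<close>

lemma AE_arms: "AE h in P. \<forall>n. fst (h n) \<in> {1..K} \<and> (n < K \<longrightarrow> fst (h n) = Suc n)"
  unfolding AE_all_countable
proof
  fix n
  \<comment> \<open>\<open>bad\<close> marks the forbidden arms of round \<open>n + 1\<close>; its
    expectation vanishes because the kernel gives them no mass.\<close>
  define bad where "bad i = (if i \<in> {1..K} \<and> (n < K \<longrightarrow> i = Suc n) then 0 else 1 :: ennreal)" for i
  have m: "(\<lambda>h. bad (fst (h n))) \<in> borel_measurable (PiM I (\<lambda>_. round_space))" if "n \<in> I" for I
    by (rule measurable_compose[OF measurable_round_fst[OF that], where g=bad]) auto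
  have "(\<integral>\<^sup>+h. bad (fst (h n)) \<partial>P) = (\<integral>\<^sup>+h. (\<Sum>a\<in>{1..K}. ennreal (q n h a)
      * (\<integral>\<^sup>+y. bad (fst ((h(n := (a, y))) n)) \<partial>\<nu> a)) \<partial>P)"
    by (rule nn_integral_law_step) (rule m, auto)
  also have "\<dots> = (\<integral>\<^sup>+h. 0 \<partial>P)"
  proof (rule nn_integral_cong)
    fix h
    have "ennreal (q n h a) * (\<integral>\<^sup>+y. bad (fst ((h(n := (a, y))) n)) \<partial>\<nu> a) = 0" if "a \<in> {1..K}" for a
    proof (cases "n < K \<and> a \<noteq> Suc n")
      case True
      then have "q n h a = 0"
        by (simp add: ms_arm_def)
      then show ?thesis by simp
    qed (use that in \<open>auto simp: bad_def\<close>)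
    then show "(\<Sum>a\<in>{1..K}. ennreal (q n h a) * (\<integral>\<^sup>+y. bad (fst ((h(n := (a, y))) n)) \<partial>\<nu> a)) = 0"
      by (intro sum.neutral) auto
  qed
  finally have "(\<integral>\<^sup>+h. bad (fst (h n)) \<partial>P) = 0"
    by simp
  moreover have "(\<lambda>h. bad (fst (h n))) \<in> borel_measurable P"
    by (subst measurable_cong_sets[OF sets_law refl]) (rule m, simp)
  ultimately have "AE h in P. bad (fst (h n)) = 0"
    by (simp add: nn_integral_0_iff_AE)
  then show "AE h in P. fst (h n) \<in> {1..K} \<and> (n < K \<longrightarrow> fst (h n) = Suc n)"
    by eventually_elim (auto simp: bad_def split: if_splits)
qed

lemma pulls_pos:
  assumes "\<forall>n. fst (h n) \<in> {1..K} \<and> (n < K \<longrightarrow> fst (h n) = Suc n)" "a \<in> {1..K}" "K \<le> n"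
  shows "1 \<le> pulls h n a"
proof -
  have "fst (h (a - 1)) = a" and "a - 1 < n"
    using assms by auto
  then show ?thesis
    using pulls_less[of "a - 1" n h a] by simp
qed

lemma measurable_deviation:
  fixes y :: "nat \<Rightarrow> real"
  shows "(\<lambda>h. if fst (h s) = b \<and> 1 \<le> pulls h s b \<and> y (pulls h s b) \<le> \<tau> * (emp_mean h s b - m)
    then 1 else 0 :: ennreal) \<in> borel_measurable P"
proof -
  let ?M = "PiM UNIV (\<lambda>_. round_space)"
  \<comment> \<open>Since \<open>y\<close> is an arbitrary function of the count, the count is
    needed as a discrete variable; it is recovered from its real version by rounding down.\<close>
  have "(\<lambda>h. nat \<lfloor>real (pulls h s b)\<rfloor>) \<in> measurable ?M (count_space UNIV)"
    by (intro measurable_compose[OF measurable_compose[OF measurable_pulls' measurable_real_floor],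
          where g=nat]) auto
  then have p: "(\<lambda>h. pulls h s b) \<in> measurable ?M (count_space UNIV)"
    by simp
  have *: "(\<lambda>h. if f h = b \<and> 1 \<le> g h \<and> y (g h) \<le> \<tau> * (k h - m) then 1 else 0 :: ennreal) \<in> borel_measurable M"
    if [measurable]: "f \<in> measurable M (count_space UNIV)" "g \<in> measurable M (count_space UNIV)"
      "k \<in> borel_measurable M"
    for M :: "history measure" and f g :: "history \<Rightarrow> nat" and k :: "history \<Rightarrow> real"
    by measurable
  show ?thesis
    by (subst measurable_cong_sets[OF sets_law refl])
       (rule *[OF measurable_round_fst[OF UNIV_I] p measurable_emp_mean'[OF subset_UNIV]])
qed

text \<open>Distinct pulls have distinct counts, so at most \<open>u\<close> rounded up can
  occur.\<close>

lemma early_pulls_le: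
  assumes "0 < u"
  shows "(\<Sum>s<T. if fst (h s) = a \<and> real (pulls h s a) < u then 1 else 0 :: ennreal) \<le> ennreal (u + 1)"
proof -
  let ?S = "{s. s < T \<and> fst (h s) = a \<and> real (pulls h s a) < u}"
  have "(\<Sum>s<T. if fst (h s) = a \<and> real (pulls h s a) < u then 1 else 0 :: ennreal) = of_nat (card ?S)"
    by (simp add: sum.If_cases Int_def)
  also have "card ?S \<le> card {..<nat \<lceil>u\<rceil>}"
    by (rule card_inj_on_le[where f="\<lambda>s. pulls h s a"])
       (auto intro: inj_on_subset[OF inj_on_pulls[of h a]] simp: less_ceiling_iff zless_nat_eq_int_zless)
  then have "of_nat (card ?S) \<le> ennreal (real (nat \<lceil>u\<rceil>))"
    by (simp add: ennreal_of_nat_eq_real_of_nat ennreal_leI)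
  also have "\<dots> \<le> ennreal (u + 1)"
    using assms by (intro ennreal_leI) linarith
  finally show ?thesis by simp
qed

text \<open>Each such round pulls \<open>a\<close> with conditional probability at most
  \<open>exp (- L) * (1 + L)\<close>. Summing over all \<open>T\<close> rounds is affordable because
  \<open>L\<close> will make this at most \<open>2 / x\<close>.\<close>

lemma nn_integral_large_gap_pulls:
  assumes a: "a \<in> {1..K}" and u: "0 < u" and \<delta>: "0 < \<delta>" and L: "0 \<le> L" "2 * \<sigma>\<^sup>2 * L \<le> u * \<delta>\<^sup>2"
  shows "(\<integral>\<^sup>+h. (\<Sum>s<T. (if K \<le> s \<and> u \<le> real (pulls h s a) \<and> \<delta> \<le> emp_gap K h s a then 1 else 0)
      * (if fst (h s) = a then 1 else 0)) \<partial>P) \<le> ennreal (real T * (exp (- L) * (1 + L)))"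
proof -
  interpret prob_space P by (rule prob_space_law)
  define e where "e s h = (if K \<le> s \<and> u \<le> real (pulls h s a) \<and> \<delta> \<le> emp_gap K h s a then 1 else 0 :: ennreal)" for s h
  have me: "e s \<in> borel_measurable (PiM I (\<lambda>_. round_space))" if I: "{0..<s} \<subseteq> I" for s I
  proof -
    have *: "(\<lambda>h. if K \<le> s \<and> u \<le> f h \<and> \<delta> \<le> g h - k h then 1 else 0 :: ennreal) \<in> borel_measurable M"
      if [measurable]: "f \<in> borel_measurable M" "g \<in> borel_measurable M" "k \<in> borel_measurable M"
      for M :: "history measure" and f g k :: "history \<Rightarrow> real"
      by measurable
    show ?thesis
      unfolding e_def[abs_def] emp_gap_def
      by (rule *[OF measurable_pulls'[OF I] measurable_best_emp_mean'[OF I] measurable_emp_mean'[OF I]])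
  qed
  have e_cong: "e s h = e s h'" if "\<And>r. r < s \<Longrightarrow> h r = h' r" for s h h'
    using pulls_cong[of s h h' a] emp_gap_cong[of s h h' K a] that by (simp add: e_def)
  have meP: "e s \<in> borel_measurable P" for s
    by (subst measurable_cong_sets[OF sets_law refl]) (rule me, simp)
  have "(\<integral>\<^sup>+h. (\<Sum>s<T. e s h * (if fst (h s) = a then 1 else 0)) \<partial>P)
      = (\<Sum>s<T. \<integral>\<^sup>+h. e s h * (if fst (h s) = a then 1 else 0) \<partial>P)"
    by (rule nn_integral_sum) (intro borel_measurable_times_ennreal meP measurable_arm_law)
  also have "\<dots> = (\<Sum>s<T. \<integral>\<^sup>+h. e s h * ennreal (q s h a) \<partial>P)"
    by (intro sum.cong refl nn_integral_arm a me e_cong) auto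
  also have "\<dots> \<le> (\<Sum>s<T. \<integral>\<^sup>+h. ennreal (exp (- L) * (1 + L)) \<partial>P)"
  proof (intro sum_mono nn_integral_mono)
    fix s h
    show "e s h * ennreal (q s h a) \<le> ennreal (exp (- L) * (1 + L))"
    proof (cases "K \<le> s \<and> u \<le> real (pulls h s a) \<and> \<delta> \<le> emp_gap K h s a")
      case True
      have "u * \<delta>\<^sup>2 \<le> real (pulls h s a) * (emp_gap K h s a)\<^sup>2"
        using True u \<delta> by (intro mult_mono power_mono) auto
      then have "L \<le> \<kappa> s h a"
        using L \<sigma> by (simp add: le_divide_eq mult.commute)
      then have "q s h a \<le> exp (- L) * (1 + L)"
        using True \<delta> L a by (intro q_le_of_large_gap) auto
      then show ?thesis
        using True by (simp add: e_def ennreal_leI)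
    qed (auto simp: e_def)
  qed
  also have "\<dots> = ennreal (real T * (exp (- L) * (1 + L)))"
    using L by (simp add: emeasure_space_1 ennreal_mult' ennreal_of_nat_eq_real_of_nat)
  finally show ?thesis
    unfolding e_def .
qed

text \<open>Counting per pull leads to a geometric series, bounded independently of
  \<open>T\<close>.\<close>

lemma nn_integral_overestimated_pulls:
  assumes a: "a \<in> {1..K}" and \<epsilon>: "0 < \<epsilon>"
  shows "(\<integral>\<^sup>+h. (\<Sum>s<T. if fst (h s) = a \<and> 1 \<le> pulls h s a \<and>
      \<epsilon> \<le> 1 * (emp_mean h s a - mean (\<nu> a)) then 1 else 0) \<partial>P) \<le> ennreal (1 / (\<epsilon>\<^sup>2 / (2 * \<sigma>\<^sup>2)))"
proof -
  have "(\<integral>\<^sup>+h. (\<Sum>s<T. if fst (h s) = a \<and> 1 \<le> pulls h s a \<and>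
      \<epsilon> \<le> 1 * (emp_mean h s a - mean (\<nu> a)) then 1 else 0) \<partial>P)
    \<le> (\<Sum>n\<in>{1..T}. ennreal (exp (- (real n * \<epsilon>\<^sup>2 / (2 * \<sigma>\<^sup>2)))))"
    using \<epsilon> by (intro nn_integral_deviation[where y="\<lambda>_. \<epsilon>"] a) auto
  also have "\<dots> = ennreal (\<Sum>n\<in>{1..T}. exp (- (real n * (\<epsilon>\<^sup>2 / (2 * \<sigma>\<^sup>2)))))"
    by simp
  also have "\<dots> \<le> ennreal (1 / (\<epsilon>\<^sup>2 / (2 * \<sigma>\<^sup>2)))"
    using \<epsilon> \<sigma> by (intro ennreal_leI sum_exp_le) auto
  finally show ?thesis .
qed

text \<open>Pulls of \<open>a\<close> are exchanged for their probability, this for a multiple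
  \<open>r\<close> of the probability of \<open>b\<close>, and this for pulls of \<open>b\<close>.
  Splitting \<open>r\<close> into levels turns each level into a count of deviating pulls of
  \<open>b\<close>.\<close>

lemma nn_integral_underestimated_pulls:
  assumes a: "a \<in> {1..K}" and b: "b \<in> {1..K}" and \<epsilon>: "0 < \<epsilon>" and u: "0 < u"
    and x: "1 \<le> x" "real T / u \<le> x"
  shows "(\<integral>\<^sup>+h. (\<Sum>s<T. (if K \<le> s \<and> u \<le> real (pulls h s a) \<and> best_emp_mean K h s \<le> mean (\<nu> b) - \<epsilon> then 1 else 0)
      * (if fst (h s) = a then 1 else 0)) \<partial>P)
    \<le> ennreal (B * (1 + ln (1 + ln x)) * (level_const D / (\<epsilon>\<^sup>2 / (2 * \<sigma>\<^sup>2))))"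
proof -
  define W where "W = B * (1 + ln (1 + ln x))"
  have W: "0 \<le> W"
    unfolding W_def using B x ln_ge_zero[of x] by (intro mult_nonneg_nonneg add_nonneg_nonneg) auto
  define m where "m = mean (\<nu> b) - \<epsilon>"
  define e where "e s h = (if K \<le> s \<and> u \<le> real (pulls h s a) \<and> best_emp_mean K h s \<le> m then 1 else 0 :: ennreal)" for s h
  define k where "k s h = real (pulls h s b) * (m - emp_mean h s b)\<^sup>2 / (2 * \<sigma>\<^sup>2)" for s h
  define r where "r s h = ennreal (W * (exp (k s h) / (1 + D * k s h)))" for s h
  define y where "y j n = \<epsilon> + sqrt (2 * \<sigma>\<^sup>2 * real j / real n)" for j n
  define d where "d j s h = (if fst (h s) = b \<and> 1 \<le> pulls h s b \<and>
      y j (pulls h s b) \<le> - 1 * (emp_mean h s b - mean (\<nu> b)) then 1 else 0 :: ennreal)" for j s and h :: history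
  define f where "f j = ennreal (exp (real j + 1) / (1 + D * real j))" for j
  have md: "d j s \<in> borel_measurable P" for j s
    unfolding d_def[abs_def] by (rule measurable_deviation)
  have me: "e s \<in> borel_measurable (PiM I (\<lambda>_. round_space))" if I: "{0..<s} \<subseteq> I" for s I
  proof -
    have *: "(\<lambda>h. if K \<le> s \<and> u \<le> f h \<and> g h \<le> m then 1 else 0 :: ennreal) \<in> borel_measurable M"
      if [measurable]: "f \<in> borel_measurable M" "g \<in> borel_measurable M"
      for M :: "history measure" and f g :: "history \<Rightarrow> real"
      by measurable
    show ?thesis
      unfolding e_def[abs_def] by (rule *[OF measurable_pulls'[OF I] measurable_best_emp_mean'[OF I]])
  qed
  have mr: "r s \<in> borel_measurable (PiM I (\<lambda>_. round_space))" if I: "{0..<s} \<subseteq> I" for s I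
  proof -
    have *: "(\<lambda>h. ennreal (W * (exp (f h * (m - g h)\<^sup>2 / (2 * \<sigma>\<^sup>2)) / (1 + D * (f h * (m - g h)\<^sup>2 / (2 * \<sigma>\<^sup>2))))))
        \<in> borel_measurable M"
      if [measurable]: "f \<in> borel_measurable M" "g \<in> borel_measurable M"
      for M :: "history measure" and f g :: "history \<Rightarrow> real"
      by measurable
    show ?thesis
      unfolding r_def[abs_def] k_def by (rule *[OF measurable_pulls'[OF I] measurable_emp_mean'[OF I]])
  qed
  have e_cong: "e s h = e s h'" if "\<And>r. r < s \<Longrightarrow> h r = h' r" for s h h'
    using pulls_cong[of s h h' a] best_emp_mean_cong[of s h h' K] that by (simp add: e_def)
  have r_cong: "r s h = r s h'" if "\<And>r. r < s \<Longrightarrow> h r = h' r" for s h h'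
    using pulls_cong[of s h h' b] emp_mean_cong[of s h h' b] that by (simp add: r_def k_def)
  have meP: "e s \<in> borel_measurable P" and mrP: "r s \<in> borel_measurable P" for s
    by (subst measurable_cong_sets[OF sets_law refl], rule me mr, simp)+
  have charge: "e s h * ennreal (q s h a) \<le> (e s h * r s h) * ennreal (q s h b)" if "s < T" for s h
  proof (cases "K \<le> s \<and> u \<le> real (pulls h s a) \<and> best_emp_mean K h s \<le> m")
    case True
    have "q s h a \<le> W * (exp (k s h) / (1 + D * k s h)) * q s h b"
      unfolding k_def using True x u that a b
      by (intro q_le_q_underestimated) (auto simp: W_def intro!: weight_le)
    then have "ennreal (q s h a) \<le> ennreal (W * (exp (k s h) / (1 + D * k s h)) * q s h b)"
      by (rule ennreal_leI)
    also have "\<dots> = r s h * ennreal (q s h b)"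
      unfolding r_def by (rule ennreal_mult'') simp
    finally show ?thesis
      using True by (simp add: e_def)
  qed (auto simp: e_def)
  \<comment> \<open>Only almost surely, because the initial rounds must have pulled
    \<open>b\<close>.\<close>
  have levels: "AE h in P. \<forall>s. (e s h * r s h) * (if fst (h s) = b then 1 else 0) \<le> ennreal W * (\<Sum>j. f j * d j s h)"
    using AE_arms
  proof eventually_elim
    case (elim h)
    show ?case
    proof
      fix s
      show "(e s h * r s h) * (if fst (h s) = b then 1 else 0) \<le> ennreal W * (\<Sum>j. f j * d j s h)"
      proof (cases "(K \<le> s \<and> u \<le> real (pulls h s a) \<and> best_emp_mean K h s \<le> m) \<and> fst (h s) = b")
        case True
        have N: "1 \<le> pulls h s b"
          using pulls_pos[OF elim b] True by auto
        have le: "emp_mean h s b \<le> m"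
          using emp_mean_le_best[OF b, of h s] True by linarith
        \<comment> \<open>For \<open>N = pulls h s b\<close>, level \<open>j\<close> puts the
          empirical mean at least \<open>sqrt (2 * \<sigma>\<^sup>2 * j / N)\<close> below
          \<open>m\<close>, and \<open>m\<close> lies \<open>\<epsilon>\<close> below the true mean;
          the shortfalls add up to \<open>y j N\<close>.\<close>
        have "(if real j \<le> k s h then 1 else 0) \<le> d j s h" for j
        proof (cases "real j \<le> k s h")
          case j: True
          have "2 * \<sigma>\<^sup>2 * real j / real (pulls h s b) \<le> (m - emp_mean h s b)\<^sup>2"
            using j N \<sigma> by (simp add: k_def field_simps)
          then have "sqrt (2 * \<sigma>\<^sup>2 * real j / real (pulls h s b)) \<le> m - emp_mean h s b"
            using le by (intro real_le_lsqrt) auto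
          then have "y j (pulls h s b) \<le> - 1 * (emp_mean h s b - mean (\<nu> b))"
            by (simp add: y_def m_def)
          then show ?thesis
            using True N by (simp add: d_def)
        qed simp
        then have "(\<Sum>j. f j * (if real j \<le> k s h then 1 else 0)) \<le> (\<Sum>j. f j * d j s h)"
          by (intro suminf_le mult_left_mono) auto
        moreover have "ennreal (exp (k s h) / (1 + D * k s h)) \<le> (\<Sum>j. f j * (if real j \<le> k s h then 1 else 0))"
          unfolding f_def using D by (intro exp_div_le_suminf_levels) (auto simp: k_def)
        ultimately have "ennreal (exp (k s h) / (1 + D * k s h)) \<le> (\<Sum>j. f j * d j s h)"
          by (rule order.trans[rotated])
        then have "ennreal W * ennreal (exp (k s h) / (1 + D * k s h)) \<le> ennreal W * (\<Sum>j. f j * d j s h)"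
          by (rule mult_left_mono) simp
        moreover have "r s h = ennreal W * ennreal (exp (k s h) / (1 + D * k s h))"
          unfolding r_def using W by (rule ennreal_mult')
        ultimately show ?thesis
          using True by (simp add: e_def)
      qed (auto simp: e_def)
    qed
  qed
  have "(\<integral>\<^sup>+h. (\<Sum>s<T. e s h * (if fst (h s) = a then 1 else 0)) \<partial>P)
      = (\<Sum>s<T. \<integral>\<^sup>+h. e s h * (if fst (h s) = a then 1 else 0) \<partial>P)"
    by (rule nn_integral_sum) (intro borel_measurable_times_ennreal meP measurable_arm_law)
  also have "\<dots> = (\<Sum>s<T. \<integral>\<^sup>+h. e s h * ennreal (q s h a) \<partial>P)"
    by (intro sum.cong refl nn_integral_arm a me e_cong) auto
  also have "\<dots> \<le> (\<Sum>s<T. \<integral>\<^sup>+h. (e s h * r s h) * ennreal (q s h b) \<partial>P)"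
    by (intro sum_mono nn_integral_mono charge) auto
  \<comment> \<open>Conditioning runs backwards here: \<open>e\<close> and \<open>r\<close> depend
    on the past only, so the probability of \<open>b\<close> becomes its indicator again.\<close>
  also have "\<dots> = (\<Sum>s<T. \<integral>\<^sup>+h. (e s h * r s h) * (if fst (h s) = b then 1 else 0) \<partial>P)"
    by (intro sum.cong refl nn_integral_arm[symmetric] b borel_measurable_times_ennreal me mr arg_cong2[where f="(*)"] e_cong r_cong) auto
  also have "\<dots> \<le> (\<Sum>s<T. \<integral>\<^sup>+h. ennreal W * (\<Sum>j. f j * d j s h) \<partial>P)"
    by (intro sum_mono nn_integral_mono_AE) (use levels in eventually_elim, auto)
  also have "\<dots> = ennreal W * (\<Sum>s<T. \<Sum>j. f j * (\<integral>\<^sup>+h. d j s h \<partial>P))"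
  proof -
    have [measurable]: "d j s \<in> borel_measurable P" for j s
      by (rule md)
    have "(\<integral>\<^sup>+h. ennreal W * (\<Sum>j. f j * d j s h) \<partial>P) = ennreal W * (\<Sum>j. f j * (\<integral>\<^sup>+h. d j s h \<partial>P))" for s
      by (subst nn_integral_cmult, measurable, subst nn_integral_suminf, measurable)
         (simp add: nn_integral_cmult)
    then show ?thesis
      by (simp add: sum_distrib_left)
  qed
  \<comment> \<open>The rounds are summed inside the integral so that each level can be counted per
    pull of \<open>b\<close>.\<close>
  also have "(\<Sum>s<T. \<Sum>j. f j * (\<integral>\<^sup>+h. d j s h \<partial>P)) = (\<Sum>j. f j * (\<integral>\<^sup>+h. (\<Sum>s<T. d j s h) \<partial>P))"
    by (simp add: suminf_sum[symmetric] summableI nn_integral_sum md sum_distrib_left)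
  also have "\<dots> \<le> (\<Sum>j. f j * ennreal (exp (- real j) * ((if j = 0 then 1 else 1 / (2 * real j)) / (\<epsilon>\<^sup>2 / (2 * \<sigma>\<^sup>2)))))"
  proof (intro suminf_le mult_left_mono)
    fix j
    have "(\<integral>\<^sup>+h. (\<Sum>s<T. d j s h) \<partial>P) \<le> (\<Sum>n\<in>{1..T}. ennreal (exp (- (real n * (y j n)\<^sup>2 / (2 * \<sigma>\<^sup>2)))))"
      unfolding d_def using \<epsilon> by (intro nn_integral_deviation b) (auto simp: y_def)
    also have "\<dots> = ennreal (\<Sum>n\<in>{1..T}. exp (- (real n * (y j n)\<^sup>2 / (2 * \<sigma>\<^sup>2))))"
      by simp
    also have "\<dots> \<le> ennreal (exp (- real j) * ((if j = 0 then 1 else 1 / (2 * real j)) / (\<epsilon>\<^sup>2 / (2 * \<sigma>\<^sup>2))))"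
      unfolding y_def by (intro ennreal_leI sum_exp_shifted_deviation_le \<epsilon> \<sigma>)
    finally show "(\<integral>\<^sup>+h. (\<Sum>s<T. d j s h) \<partial>P) \<le> \<dots>" .
  qed auto
  also have "\<dots> \<le> ennreal (level_const D / (\<epsilon>\<^sup>2 / (2 * \<sigma>\<^sup>2)))"
    unfolding f_def using \<epsilon> \<sigma> D by (intro suminf_levels_le) auto
  finally have "(\<integral>\<^sup>+h. (\<Sum>s<T. e s h * (if fst (h s) = a then 1 else 0)) \<partial>P)
      \<le> ennreal W * ennreal (level_const D / (\<epsilon>\<^sup>2 / (2 * \<sigma>\<^sup>2)))"
    by (simp add: mult_left_mono)
  then show ?thesis
    unfolding e_def m_def W_def[symmetric] ennreal_mult'[OF W] .
qed

text \<open>The summands are the early pulls and the three cases. \<open>L\<close> and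
  \<open>x\<close> stay free, tied only by \<open>real T / u \<le> x\<close>; their calibration is a
  separate real computation.\<close>

lemma nn_integral_pulls_le:
  assumes a: "a \<in> {1..K}" and b: "b \<in> {1..K}" and c: "0 < c" and \<Delta>: "0 < \<Delta>" "mean (\<nu> a) + \<Delta> \<le> mean (\<nu> b)"
    and L: "0 < L" and x: "1 \<le> x"
  defines "u \<equiv> 2 * \<sigma>\<^sup>2 * (1 + c)\<^sup>2 * L / \<Delta>\<^sup>2" and "\<theta> \<equiv> (c * \<Delta> / (2 * (1 + c)))\<^sup>2 / (2 * \<sigma>\<^sup>2)"
  assumes T: "real T / u \<le> x"
  shows "(\<integral>\<^sup>+h. ennreal (real (pulls h T a)) \<partial>P)
    \<le> ennreal (u + 1) + ennreal (real T * (exp (- L) * (1 + L))) + ennreal (1 / \<theta>)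
      + ennreal (B * (1 + ln (1 + ln x)) * (level_const D / \<theta>))"
proof -
  interpret prob_space P by (rule prob_space_law)
  define \<epsilon> where "\<epsilon> = c * \<Delta> / (2 * (1 + c))"
  define \<delta> where "\<delta> = \<Delta> / (1 + c)"
  have u: "0 < u"
    using \<sigma> c L \<Delta> by (simp add: u_def)
  \<comment> \<open>The gap is divided into \<open>\<delta>\<close> and one slack
    \<open>\<epsilon>\<close> for each of \<open>a\<close> and \<open>b\<close>. Shrinking it to
    \<open>\<Delta> / (1 + c)\<close> costs the factor \<open>(1 + c)\<^sup>2\<close> in
    \<open>u\<close>.\<close>
  have \<epsilon>: "0 < \<epsilon>" and \<delta>: "0 < \<delta>" and split: "\<delta> + 2 * \<epsilon> = \<Delta>"
  proof -
    show "0 < \<epsilon>" "0 < \<delta>"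
      using c \<Delta> by (auto simp: \<epsilon>_def \<delta>_def)
    have "2 * \<epsilon> = c * \<Delta> / (1 + c)"
      using c unfolding \<epsilon>_def by (subst times_divide_eq_right, subst mult_divide_mult_cancel_left) auto
    then have "\<delta> + 2 * \<epsilon> = (1 + c) * \<Delta> / (1 + c)"
      by (simp add: \<delta>_def add_divide_distrib distrib_right)
    then show "\<delta> + 2 * \<epsilon> = \<Delta>"
      using c by simp
  qed
  define i1 where "i1 s h = (if fst (h s) = a \<and> real (pulls h s a) < u then 1 else 0 :: ennreal)" for s and h :: history
  define i2 where "i2 s h = (if K \<le> s \<and> u \<le> real (pulls h s a) \<and> \<delta> \<le> emp_gap K h s a then 1 else 0)
      * (if fst (h s) = a then 1 else 0 :: ennreal)" for s and h :: history
  define i3 where "i3 s h = (if fst (h s) = a \<and> 1 \<le> pulls h s a \<and>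
      \<epsilon> \<le> 1 * (emp_mean h s a - mean (\<nu> a)) then 1 else 0 :: ennreal)" for s and h :: history
  define i4 where "i4 s h = (if K \<le> s \<and> u \<le> real (pulls h s a) \<and> best_emp_mean K h s \<le> mean (\<nu> b) - \<epsilon> then 1 else 0)
      * (if fst (h s) = a then 1 else 0 :: ennreal)" for s and h :: history
  have "AE h in P. ennreal (real (pulls h T a))
      \<le> ennreal (u + 1) + (\<Sum>s<T. i2 s h) + (\<Sum>s<T. i3 s h) + (\<Sum>s<T. i4 s h)"
    using AE_arms
  proof eventually_elim
    case (elim h)
    have "(if fst (h s) = a then 1 else 0) \<le> i1 s h + i2 s h + i3 s h + i4 s h" for s
    proof (cases "fst (h s) = a \<and> u \<le> real (pulls h s a)")
      case True
      then have N: "1 \<le> pulls h s a"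
        using u by (cases "pulls h s a") auto
      \<comment> \<open>A repeated pull cannot be initial, since the initial rounds pull every arm
        once.\<close>
      have "K \<le> s"
      proof (rule ccontr)
        assume "\<not> K \<le> s"
        then have "a = Suc s"
          using elim True by auto
        from N obtain s' where "s' < s" "fst (h s') = a"
          by (auto simp: pulls_def card_gt_0_iff Suc_le_eq)
        then show False
          using elim \<open>\<not> K \<le> s\<close> \<open>a = Suc s\<close> by (metis less_trans nat_neq_iff not_le Suc_inject)
      qed
      \<comment> \<open>If the first two fail, the best empirical mean is below
        \<open>mean (\<nu> a) + \<epsilon> + \<delta>\<close>, which is at most
        \<open>mean (\<nu> b) - \<epsilon>\<close>.\<close>
      moreover have "\<delta> \<le> emp_gap K h s a \<or> \<epsilon> \<le> emp_mean h s a - mean (\<nu> a) \<or> best_emp_mean K h s \<le> mean (\<nu> b) - \<epsilon>"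
        using split \<Delta>(2) unfolding emp_gap_def by linarith
      ultimately show ?thesis
        using True N by (auto simp: i2_def i3_def i4_def intro: add_increasing add_increasing2)
    qed (auto simp: i1_def)
    then have "(\<Sum>s<T. if fst (h s) = a then 1 else 0) \<le> (\<Sum>s<T. i1 s h + i2 s h + i3 s h + i4 s h)"
      by (rule sum_mono)
    moreover have "(\<Sum>s<T. if fst (h s) = a then 1 else 0) = ennreal (real (pulls h T a))"
      by (simp add: pulls_eq_sum ennreal_of_nat_eq_real_of_nat[symmetric] sum.If_cases)
    moreover have "(\<Sum>s<T. i1 s h) \<le> ennreal (u + 1)"
      unfolding i1_def by (rule early_pulls_le[OF u])
    ultimately show ?case
      by (simp add: sum.distrib) (meson add_right_mono order.trans)
  qed
  then have "(\<integral>\<^sup>+h. ennreal (real (pulls h T a)) \<partial>P)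
      \<le> (\<integral>\<^sup>+h. ennreal (u + 1) + (\<Sum>s<T. i2 s h) + (\<Sum>s<T. i3 s h) + (\<Sum>s<T. i4 s h) \<partial>P)"
    by (rule nn_integral_mono_AE)
  also have "\<dots> = ennreal (u + 1) + (\<integral>\<^sup>+h. (\<Sum>s<T. i2 s h) \<partial>P) + (\<integral>\<^sup>+h. (\<Sum>s<T. i3 s h) \<partial>P) + (\<integral>\<^sup>+h. (\<Sum>s<T. i4 s h) \<partial>P)"
  proof -
    have m3: "i3 s \<in> borel_measurable P" for s
      unfolding i3_def[abs_def] using measurable_deviation[where y="\<lambda>_. \<epsilon>"] .
    have m2: "i2 s \<in> borel_measurable P" and m4: "i4 s \<in> borel_measurable P" for s
    proof -
      have *: "(\<lambda>h. if K \<le> s \<and> u \<le> f h \<and> \<delta> \<le> g h - k h then 1 else 0 :: ennreal) \<in> borel_measurable M"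
        "(\<lambda>h. if K \<le> s \<and> u \<le> f h \<and> g h \<le> mean (\<nu> b) - \<epsilon> then 1 else 0 :: ennreal) \<in> borel_measurable M"
        if [measurable]: "f \<in> borel_measurable M" "g \<in> borel_measurable M" "k \<in> borel_measurable M"
        for M :: "history measure" and f g k :: "history \<Rightarrow> real"
        by measurable
      note ** = *[OF measurable_pulls'[OF subset_UNIV] measurable_best_emp_mean'[OF subset_UNIV]
          measurable_emp_mean'[OF subset_UNIV]]
      show "i2 s \<in> borel_measurable P" "i4 s \<in> borel_measurable P"
        unfolding i2_def[abs_def] i4_def[abs_def] emp_gap_def measurable_cong_sets[OF sets_law refl]
        by (intro borel_measurable_times_ennreal measurable_arm UNIV_I **)+
    qed
    note [measurable] = m2 m3 m4
    show ?thesis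
      by (simp add: nn_integral_add emeasure_space_1)
  qed
  also have "\<dots> \<le> ennreal (u + 1) + ennreal (real T * (exp (- L) * (1 + L))) + ennreal (1 / \<theta>)
      + ennreal (B * (1 + ln (1 + ln x)) * (level_const D / \<theta>))"
  proof (intro add_mono order.refl)
    \<comment> \<open>The form of \<open>u\<close> comes from here:
      \<open>u * \<delta>\<^sup>2\<close> equals \<open>2 * \<sigma>\<^sup>2 * L\<close>.\<close>
    show "(\<integral>\<^sup>+h. (\<Sum>s<T. i2 s h) \<partial>P) \<le> ennreal (real T * (exp (- L) * (1 + L)))"
      unfolding i2_def using \<delta> u L a \<Delta> c
      by (intro nn_integral_large_gap_pulls) (auto simp: u_def \<delta>_def power_divide)
    show "(\<integral>\<^sup>+h. (\<Sum>s<T. i3 s h) \<partial>P) \<le> ennreal (1 / \<theta>)"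
      unfolding i3_def \<theta>_def \<epsilon>_def[symmetric] by (rule nn_integral_overestimated_pulls[OF a \<epsilon>])
    show "(\<integral>\<^sup>+h. (\<Sum>s<T. i4 s h) \<partial>P) \<le> ennreal (B * (1 + ln (1 + ln x)) * (level_const D / \<theta>))"
      unfolding i4_def \<theta>_def \<epsilon>_def[symmetric]
      by (rule nn_integral_underestimated_pulls[OF a b \<epsilon> u x T])
  qed
  finally show ?thesis .
qed

section \<open>Calibration of the constants and passage to the regret\<close>

lemma integral_pulls_le:
  assumes "(\<integral>\<^sup>+h. ennreal (real (pulls h T a)) \<partial>P) \<le> ennreal R" "0 \<le> R"
  shows "(\<integral>h. real (pulls h T a) \<partial>P) \<le> R"
proof -
  have "(\<lambda>h. real (pulls h T a)) \<in> borel_measurable P"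
    by (subst measurable_cong_sets[OF sets_law refl]) (rule measurable_pulls', simp)
  then have "(\<integral>h. real (pulls h T a) \<partial>P) = enn2real (\<integral>\<^sup>+h. ennreal (real (pulls h T a)) \<partial>P)"
    by (intro integral_eq_nn_integral) auto
  also have "\<dots> \<le> R"
    using assms by (simp add: enn2real_leI)
  finally show ?thesis .
qed

text \<open>All lower-order terms are compared with \<open>B * (Q * l)\<close>. For
  \<open>x < exp 1\<close> the trivial bound by \<open>T\<close> is good enough; otherwise the
  threshold \<open>L = ln (x * (1 + ln (1 + x)))\<close> is inserted.\<close>

lemma expected_pulls_le:
  fixes T :: nat
  assumes a: "a \<in> {1..K}" and b: "b \<in> {1..K}" and c: "0 < c"
    and \<Delta>: "0 < \<Delta>" "mean (\<nu> a) + \<Delta> \<le> mean (\<nu> b)"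
  defines "x \<equiv> real T * \<Delta>\<^sup>2 / (2 * \<sigma>\<^sup>2)"
  shows "(\<integral>h. real (pulls h T a) \<partial>P)
    \<le> 2 * \<sigma>\<^sup>2 * (1 + c)\<^sup>2 * ln (max 1 (x * (1 + ln (1 + x)))) / \<Delta>\<^sup>2
      + (24 + 24 * level_const D) * (B * (\<sigma>\<^sup>2 * (1 + c)\<^sup>2 * ln (1 + ln (max (exp 1) x)) / (c\<^sup>2 * \<Delta>\<^sup>2)) + 1)"
proof -
  define l where "l = ln (1 + ln (max (exp 1) x))"
  define Q where "Q = \<sigma>\<^sup>2 * (1 + c)\<^sup>2 / (c\<^sup>2 * \<Delta>\<^sup>2)"
  define G where "G = level_const D"
  have G: "0 < G"
    unfolding G_def using D level_const_pos by simp
  have Q: "0 < Q"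
    unfolding Q_def using \<sigma> c \<Delta> by simp
  \<comment> \<open>The guard \<open>exp 1\<close> keeps \<open>l\<close> at least
    \<open>ln 2\<close>, so \<open>l\<close> absorbs constants at the price of a factor 2.\<close>
  have "1 \<le> ln (max (exp 1) x)"
    by (subst ln_ge_iff) (auto simp: less_max_iff_disj)
  then have "ln 2 \<le> l"
    unfolding l_def by (intro ln_mono) auto
  then have l: "1 / 2 \<le> l"
    using ln2_ge_two_thirds by linarith
  have Ql: "Q \<le> 2 * (B * (Q * l))"
  proof -
    have "1 * (1 / 2) \<le> B * l"
      using B l by (intro mult_mono) auto
    then have "Q * 1 \<le> Q * (2 * (B * l))"
      using Q by (intro mult_left_mono) auto
    then show ?thesis by (simp add: mult_ac)
  qed
  have ratio: "\<sigma>\<^sup>2 / \<Delta>\<^sup>2 \<le> Q"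
  proof -
    have "1 \<le> (1 + c)\<^sup>2 / c\<^sup>2"
      using c by (simp add: power_mono)
    then have "\<sigma>\<^sup>2 / \<Delta>\<^sup>2 * 1 \<le> \<sigma>\<^sup>2 / \<Delta>\<^sup>2 * ((1 + c)\<^sup>2 / c\<^sup>2)"
      by (intro mult_left_mono) auto
    then show ?thesis
      by (simp add: Q_def mult_ac)
  qed
  have T: "real T = 2 * x * (\<sigma>\<^sup>2 / \<Delta>\<^sup>2)"
    using \<Delta> \<sigma> by (simp add: x_def)
  have rhs: "B * (\<sigma>\<^sup>2 * (1 + c)\<^sup>2 * ln (1 + ln (max (exp 1) x)) / (c\<^sup>2 * \<Delta>\<^sup>2)) = B * (Q * l)"
    by (simp add: Q_def l_def)
  show ?thesis
    unfolding rhs G_def[symmetric]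
  proof (cases "x < exp 1")
    case True
    \<comment> \<open>The horizon itself is of order
      \<open>\<sigma>\<^sup>2 / \<Delta>\<^sup>2\<close> here; 3 bounds
      \<open>exp 1\<close>.\<close>
    have "real T \<le> 2 * 3 * Q"
      unfolding T using True exp_le ratio by (intro mult_mono) (auto simp: x_def)
    also have "\<dots> \<le> 24 * (B * (Q * l))"
      using Ql Q by linarith
    also have "\<dots> \<le> (24 + 24 * G) * (B * (Q * l) + 1)"
      using Q B l G by (intro mult_mono) auto
    finally have "real T \<le> (24 + 24 * G) * (B * (Q * l) + 1)" .
    moreover have "0 \<le> 2 * \<sigma>\<^sup>2 * (1 + c)\<^sup>2 * ln (max 1 (x * (1 + ln (1 + x)))) / \<Delta>\<^sup>2"
      by simp
    ultimately have T_le: "real T \<le> 2 * \<sigma>\<^sup>2 * (1 + c)\<^sup>2 * ln (max 1 (x * (1 + ln (1 + x)))) / \<Delta>\<^sup>2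
        + (24 + 24 * G) * (B * (Q * l) + 1)"
      by linarith
    interpret prob_space P by (rule prob_space_law)
    have "(\<integral>\<^sup>+h. ennreal (real (pulls h T a)) \<partial>P) \<le> (\<integral>\<^sup>+h. ennreal (real T) \<partial>P)"
      by (intro nn_integral_mono ennreal_leI) (simp add: pulls_le)
    also have "\<dots> = ennreal (real T)"
      by (simp add: emeasure_space_1)
    finally have "(\<integral>h. real (pulls h T a) \<partial>P) \<le> real T"
      by (rule integral_pulls_le) simp
    with T_le show "(\<integral>h. real (pulls h T a) \<partial>P)
        \<le> 2 * \<sigma>\<^sup>2 * (1 + c)\<^sup>2 * ln (max 1 (x * (1 + ln (1 + x)))) / \<Delta>\<^sup>2 + (24 + 24 * G) * (B * (Q * l) + 1)"
      by linarith
  next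
    case False
    then have x: "exp 1 \<le> x" and x1: "1 \<le> x"
      using exp_ge_add_one_self[of "1::real"] by auto
    define X where "X = x * (1 + ln (1 + x))"
    define L where "L = ln X"
    have "0 \<le> ln (1 + x)"
      using x1 by simp
    then have X: "exp 1 \<le> X"
      unfolding X_def using x x1 mult_mono[of "exp 1" x 1 "1 + ln (1 + x)"] by simp
    then have maxX: "max 1 X = X"
      using exp_ge_add_one_self[of "1::real"] by simp
    have L: "1 \<le> L"
      unfolding L_def using X by (subst ln_ge_iff) (auto intro: less_le_trans[OF exp_gt_zero])
    define u where "u = 2 * \<sigma>\<^sup>2 * (1 + c)\<^sup>2 * L / \<Delta>\<^sup>2"
    define \<theta> where "\<theta> = (c * \<Delta> / (2 * (1 + c)))\<^sup>2 / (2 * \<sigma>\<^sup>2)"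
    have inv: "1 / \<theta> = 8 * Q"
      unfolding \<theta>_def Q_def power_divide power_mult_distrib using \<sigma> c \<Delta>
      by (simp add: divide_divide_eq_left divide_divide_eq_right mult_ac)
    have \<theta>: "0 < \<theta>"
      using \<sigma> c \<Delta> by (simp add: \<theta>_def)
    have u: "0 \<le> u"
      using L by (simp add: u_def)
    \<comment> \<open>Since \<open>(1 + c)\<^sup>2 * L \<ge> 1\<close>, \<open>u\<close> is at least
      \<open>2 * \<sigma>\<^sup>2 / \<Delta>\<^sup>2\<close>, which is
      \<open>real T / x\<close>.\<close>
    have Tu: "real T / u \<le> x"
    proof -
      have "1 * 1 \<le> (1 + c)\<^sup>2 * L"
        using c L by (intro mult_mono) (auto simp: one_le_power)
      then have "2 * \<sigma>\<^sup>2 / \<Delta>\<^sup>2 * 1 \<le> 2 * \<sigma>\<^sup>2 / \<Delta>\<^sup>2 * ((1 + c)\<^sup>2 * L)"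
        by (intro mult_left_mono) auto
      then have "x * (2 * \<sigma>\<^sup>2 / \<Delta>\<^sup>2) \<le> x * u"
        using x1 by (intro mult_left_mono) (auto simp: u_def mult_ac)
      then have "real T \<le> x * u"
        unfolding T by (simp add: mult_ac)
      moreover have "0 < u"
        unfolding u_def using \<sigma> \<Delta> c L by simp
      ultimately show ?thesis
        by (simp add: divide_le_eq)
    qed
    have A: "real T * (exp (- L) * (1 + L)) \<le> 4 * Q"
    proof -
      have "real T * (exp (- L) * (1 + L)) \<le> real T * (2 / x)"
        unfolding L_def X_def using x1 by (intro mult_left_mono exp_log_threshold_le) auto
      also have "\<dots> = 4 * (\<sigma>\<^sup>2 / \<Delta>\<^sup>2)"
        unfolding T using x1 by simp
      finally show ?thesis using ratio by linarith
    qed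
    \<comment> \<open>The 24 is 3 times 8: \<open>l \<ge> 1 / 2\<close> gives
      \<open>1 + l \<le> 3 * l\<close>, and \<open>1 / \<theta> = 8 * Q\<close>.\<close>
    have W: "B * (1 + ln (1 + ln x)) * (G / \<theta>) \<le> 24 * G * (B * (Q * l))"
    proof -
      have "l = ln (1 + ln x)"
        unfolding l_def using x by (simp add: max_absorb2)
      then have "1 + ln (1 + ln x) \<le> 3 * l"
        using l by linarith
      then have "B * (1 + ln (1 + ln x)) * (G / \<theta>) \<le> B * (3 * l) * (G / \<theta>)"
        using B G \<theta> by (intro mult_right_mono mult_left_mono) auto
      also have "\<dots> = 3 * (B * l * G * (1 / \<theta>))"
        by simp
      also have "\<dots> = 24 * G * (B * (Q * l))"
        unfolding inv by simp
      finally show ?thesis .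
    qed
    have "0 \<le> ln (1 + ln x)"
      using x1 ln_ge_zero[of x] by simp
    then have nonneg: "0 \<le> B * (1 + ln (1 + ln x)) * (G / \<theta>)" "0 \<le> u + 1"
        "0 \<le> real T * (exp (- L) * (1 + L))" "0 \<le> 1 / \<theta>"
      using B G \<theta> u L by (auto intro!: mult_nonneg_nonneg)
    have "(\<integral>\<^sup>+h. ennreal (real (pulls h T a)) \<partial>P)
      \<le> ennreal (u + 1) + ennreal (real T * (exp (- L) * (1 + L))) + ennreal (1 / \<theta>)
        + ennreal (B * (1 + ln (1 + ln x)) * (level_const D / \<theta>))"
      unfolding u_def \<theta>_def
      by (rule nn_integral_pulls_le[OF a b c \<Delta> _ x1]) (use L Tu in \<open>auto simp: u_def\<close>)
    also have "\<dots> = ennreal ((u + 1) + real T * (exp (- L) * (1 + L)) + 1 / \<theta> + B * (1 + ln (1 + ln x)) * (G / \<theta>))"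
      unfolding G_def[symmetric] by (simp only: ennreal_plus nonneg add_nonneg_nonneg)
    finally have "(\<integral>h. real (pulls h T a) \<partial>P)
        \<le> (u + 1) + real T * (exp (- L) * (1 + L)) + 1 / \<theta> + B * (1 + ln (1 + ln x)) * (G / \<theta>)"
      by (rule integral_pulls_le) (simp only: nonneg add_nonneg_nonneg)
    also have "\<dots> \<le> u + 1 + 4 * Q + 8 * Q + 24 * G * (B * (Q * l))"
      using A W inv by linarith
    \<comment> \<open>The 12 copies of \<open>Q\<close> cost 24 of \<open>B * (Q * l)\<close> by
      \<open>Ql\<close>; the rounding term 1 goes into the trailing constant.\<close>
    also have "\<dots> \<le> u + (24 + 24 * G) * (B * (Q * l) + 1)"
      using Ql G by (simp add: algebra_simps)
    finally show "(\<integral>h. real (pulls h T a) \<partial>P)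
        \<le> 2 * \<sigma>\<^sup>2 * (1 + c)\<^sup>2 * ln (max 1 (x * (1 + ln (1 + x)))) / \<Delta>\<^sup>2 + (24 + 24 * G) * (B * (Q * l) + 1)"
      unfolding X_def[symmetric] maxX L_def[symmetric] u_def[symmetric] .
  qed
qed

text \<open>Exchanging the sums over rounds and arms gives the usual regret decomposition; arms of
  gap 0 contribute nothing.\<close>

lemma expected_regret_eq:
  "expected_regret B C D \<sigma> K \<nu> T
    = (\<Sum>a | a \<in> {1..K} \<and> gap K \<nu> a > 0. gap K \<nu> a * (\<integral>h. real (pulls h T a) \<partial>P))"
proof -
  interpret prob_space P by (rule prob_space_law)
  have mp: "(\<lambda>h. real (pulls h T a)) \<in> borel_measurable P" for a
    by (subst measurable_cong_sets[OF sets_law refl]) (rule measurable_pulls', simp)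
  have int: "integrable P (\<lambda>h. real (pulls h T a))" for a
    by (rule integrable_const_bound[OF _ mp, of _ "real T"]) (auto simp: pulls_le)
  have reg: "regret K \<nu> T h = (\<Sum>s<T. gap K \<nu> (fst (h s)))" for h
    unfolding regret_def gap_def[symmetric]
    by (rule sum.reindex_bij_witness[where i=Suc and j="\<lambda>t. t - 1"]) auto
  have mr: "regret K \<nu> T \<in> borel_measurable P"
    unfolding reg[abs_def]
    by (subst measurable_cong_sets[OF sets_law refl], rule borel_measurable_sum)
       (rule measurable_compose[OF measurable_round_fst], auto)
  \<comment> \<open>Almost surely only: an arm outside \<open>{1..K}\<close> would add regret that
    the sum over arms misses.\<close>
  have "AE h in P. regret K \<nu> T h = (\<Sum>a\<in>{1..K}. gap K \<nu> a * real (pulls h T a))"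
    using AE_arms
  proof eventually_elim
    case (elim h)
    have "(\<Sum>a\<in>{1..K}. gap K \<nu> a * real (pulls h T a))
        = (\<Sum>a\<in>{1..K}. \<Sum>s<T. if fst (h s) = a then gap K \<nu> a else 0)"
      unfolding pulls_eq_sum of_nat_sum sum_distrib_left by (intro sum.cong refl) auto
    also have "\<dots> = (\<Sum>s<T. \<Sum>a\<in>{1..K}. if fst (h s) = a then gap K \<nu> a else 0)"
      by (rule sum.swap)
    also have "\<dots> = (\<Sum>s<T. gap K \<nu> (fst (h s)))"
      using elim by (intro sum.cong refl) simp
    finally show ?case
      by (simp add: reg)
  qed
  then have "expected_regret B C D \<sigma> K \<nu> T = (\<integral>h. (\<Sum>a\<in>{1..K}. gap K \<nu> a * real (pulls h T a)) \<partial>P)"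
    unfolding expected_regret_def
    by (intro integral_cong_AE mr borel_measurable_sum borel_measurable_times borel_measurable_const mp)
  also have "\<dots> = (\<Sum>a\<in>{1..K}. gap K \<nu> a * (\<integral>h. real (pulls h T a) \<partial>P))"
    by (simp add: Bochner_Integration.integral_sum int)
  also have "\<dots> = (\<Sum>a | a \<in> {1..K} \<and> gap K \<nu> a > 0. gap K \<nu> a * (\<integral>h. real (pulls h T a) \<partial>P))"
  proof (rule sum.mono_neutral_right)
    have "0 \<le> gap K \<nu> a" if "a \<in> {1..K}" for a
      unfolding gap_def using that by (simp add: Max_ge)
    then show "\<forall>a\<in>{1..K} - {a. a \<in> {1..K} \<and> gap K \<nu> a > 0}. gap K \<nu> a * (\<integral>h. real (pulls h T a) \<partial>P) = 0"
      by fastforce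
  qed auto
  finally show ?thesis .
qed

end

text \<open>\<open>A\<close> is chosen before all quantities other than \<open>C\<close> and
  \<open>D\<close>, which expresses the hidden constant. The guards \<open>max 1\<close> and
  \<open>max (exp 1)\<close> give the logarithms a sensible value for small \<open>x\<close>; for
  \<open>x \<ge> exp 1\<close> they change nothing.\<close>

theorem theorem4:
  fixes C D :: real
  assumes "0 \<le> C" "C \<le> 1" "0 < D" "D \<le> 1"
  shows "\<exists>A>0. \<forall>(\<sigma>::real) (B::real) (K::nat) (\<nu>::nat \<Rightarrow> real measure) (T::nat) (c::real).
    \<sigma> > 0 \<longrightarrow> B \<ge> 1 \<longrightarrow> bandit_instance K \<sigma> \<nu> \<longrightarrow> T \<ge> 1 \<longrightarrow> c > 0 \<longrightarrow>
    expected_regret B C D \<sigma> K \<nu> T \<le>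
      (\<Sum>a | a \<in> {1..K} \<and> gap K \<nu> a > 0.
        let \<Delta> = gap K \<nu> a; x = real T * \<Delta>\<^sup>2 / (2 * \<sigma>\<^sup>2) in
          2 * \<sigma>\<^sup>2 * (1 + c)\<^sup>2 * ln (max 1 (x * (1 + ln (1 + x)))) / \<Delta>
          + A * (B * (\<sigma>\<^sup>2 * (1 + c)\<^sup>2 * ln (1 + ln (max (exp 1) x)) / (c\<^sup>2 * \<Delta>)) + \<Delta>))"
proof (intro exI[of _ "24 + 24 * level_const D"] conjI allI impI)
  show "0 < 24 + 24 * level_const D"
    using level_const_pos[OF assms(3)] by simp
  fix \<sigma> B c :: real and K T :: nat and \<nu> :: "nat \<Rightarrow> real measure"
  assume \<sigma>: "\<sigma> > 0" and B: "B \<ge> 1" and bandit: "bandit_instance K \<sigma> \<nu>" and c: "c > 0"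
  interpret ms_bandit B C D \<sigma> K \<nu>
    using assms \<sigma> B bandit by unfold_locales
  let ?bound = "\<lambda>\<Delta> x. 2 * \<sigma>\<^sup>2 * (1 + c)\<^sup>2 * ln (max 1 (x * (1 + ln (1 + x)))) / \<Delta>
          + (24 + 24 * level_const D) * (B * (\<sigma>\<^sup>2 * (1 + c)\<^sup>2 * ln (1 + ln (max (exp 1) x)) / (c\<^sup>2 * \<Delta>)) + \<Delta>)"
  show "expected_regret B C D \<sigma> K \<nu> T \<le>
      (\<Sum>a | a \<in> {1..K} \<and> gap K \<nu> a > 0.
        let \<Delta> = gap K \<nu> a; x = real T * \<Delta>\<^sup>2 / (2 * \<sigma>\<^sup>2) in ?bound \<Delta> x)"
    unfolding expected_regret_eq
  proof (rule sum_mono)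
    fix a assume "a \<in> {a. a \<in> {1..K} \<and> gap K \<nu> a > 0}"
    then have a: "a \<in> {1..K}" and \<Delta>0: "gap K \<nu> a > 0"
      by auto
    define \<Delta> where "\<Delta> = gap K \<nu> a"
    define x where "x = real T * \<Delta>\<^sup>2 / (2 * \<sigma>\<^sup>2)"
    have "Max ((\<lambda>b. mean (\<nu> b)) ` {1..K}) \<in> (\<lambda>b. mean (\<nu> b)) ` {1..K}"
      using K by (intro Max_in) auto
    then obtain b where b: "b \<in> {1..K}" "mean (\<nu> b) = Max ((\<lambda>b. mean (\<nu> b)) ` {1..K})"
      by auto
    have \<Delta>: "0 < \<Delta>" "mean (\<nu> a) + \<Delta> \<le> mean (\<nu> b)"
      using \<Delta>0 b(2) by (auto simp: \<Delta>_def gap_def)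
    have "\<Delta> * (\<integral>h. real (pulls h T a) \<partial>P)
      \<le> \<Delta> * (2 * \<sigma>\<^sup>2 * (1 + c)\<^sup>2 * ln (max 1 (x * (1 + ln (1 + x)))) / \<Delta>\<^sup>2
        + (24 + 24 * level_const D) * (B * (\<sigma>\<^sup>2 * (1 + c)\<^sup>2 * ln (1 + ln (max (exp 1) x)) / (c\<^sup>2 * \<Delta>\<^sup>2)) + 1))"
      unfolding x_def using \<Delta> by (intro mult_left_mono expected_pulls_le[OF a b(1) c \<Delta>]) auto
    also have "\<dots> = ?bound \<Delta> x"
    proof -
      have *: "\<Delta> * (p / \<Delta>\<^sup>2 + A * (B * (r / (c\<^sup>2 * \<Delta>\<^sup>2)) + 1)) = p / \<Delta> + A * (B * (r / (c\<^sup>2 * \<Delta>)) + \<Delta>)" for p r A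
        using \<Delta>(1) c by (simp add: field_simps power2_eq_square)
      show ?thesis by (rule *)
    qed
    finally show "gap K \<nu> a * (\<integral>h. real (pulls h T a) \<partial>P)
        \<le> (let \<Delta> = gap K \<nu> a; x = real T * \<Delta>\<^sup>2 / (2 * \<sigma>\<^sup>2) in ?bound \<Delta> x)"
      unfolding Let_def x_def \<Delta>_def .
  qed
qed

end
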